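(* Let $X$ be a nonzero complex Banach space with open unit ball $\mathbb{B}$. Let $\alpha_0=(27-\sqrt{129})/24\approx0.651758$, which is a root of $24\alpha^2-54\alpha+25=0$, and let $\alpha\in[0,\alpha_0]$. Let $f:\mathbb{B}\to\mathbb{C}$ be holomorphic with $f(0)=1$ and suppose $F(z)=zf(z)$ belongs to $\mathcal{S}^*_\alpha(\mathbb{B})$. Then for every $z\in X\setminus\{0\}$ and $l_z\in T(z)$, $$\left|A_2^3-2A_2A_3^2-A_2A_4^2+2A_3^2A_4\right|\le\frac49(1-\alpha)^3(2\alpha^2-7\alpha+9)(8\alpha^2-22\alpha+21),$$ where $$A_2=\frac{l_z(D^2F(0)(z^2))}{2!\,\|z\|^2},\quad A_3=\frac{l_z(D^3F(0)(z^3))}{3!\,\|z\|^3},\quad A_4=\frac{l_z(D^4F(0)(z^4))}{4!\,\|z\|^4}.$$ The estimate is sharp.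
   Context: For $z\in X\setminus\{0\}$, $T(z)=\{l_z\in L(X,\mathbb{C}): l_z(z)=\|z\|,\ \|l_z\|=1\}$, where $L(X,\mathbb{C})$ is the space of continuous linear functionals on $X$. $D^nF(0)$ is the $n$-th Fréchet derivative at $0$ and $D^nF(0)(z^n)=D^nF(0)(z,\dots,z)$. A holomorphic mapping $F:\mathbb{B}\to X$ is normalized if $F(0)=0$ and $DF(0)=I$, and locally biholomorphic if $DF(z)$ is invertible with bounded inverse for each $z\in\mathbb{B}$. For $\alpha\in(0,1)$, $\mathcal{S}^*_\alpha(\mathbb{B})$ (starlike mappings of order $\alpha$) is the class of normalized locally biholomorphic $F$ with $$\left|\frac1{\|z\|}l_z([DF(z)]^{-1}F(z))-\frac1{2\alpha}\right|<\frac1{2\alpha}\quad\text{for all }z\in\mathbb{B}\setminus\{0\},\ l_z\in T(z).$$ Equivalently, $\dfrac{\|z\|}{l_z([DF(z)]^{-1}F(z))}\in\Phi(\mathbb{U})$ for all such $z,l_z$, where $\mathbb{U}$ is the open unit disk and $\Phi(\zeta)=\frac{1+(1-2\alpha)\zeta}{1-\zeta}$; for $\alpha=0$ the class $\mathcal{S}^*_0(\mathbb{B})$ is defined by this latter condition (it is the class $\mathcal{S}^*(\mathbb{B})$ of starlike mappings). "Sharp" means: for each such $X$ and $\alpha$ there exist an $f$ satisfying the hypotheses and a $z\in X\setminus\{0\}$, $l_z\in T(z)$ for which equality holds. *)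

theory Defs
  imports "HOL-Analysis.Analysis"
begin

class scaleC =
  fixes scaleC :: "complex \<Rightarrow> 'a \<Rightarrow> 'a"  (infixr "*\<^sub>C" 75)

text \<open>Complex Banach spaces: the underlying real Banach space is the library's
  \<^class>\<open>banach\<close>, so that its derivatives and operator norms can be used.\<close>

class complex_banach = scaleC + banach +
  assumes scaleC_add_right: "a *\<^sub>C (x + y) = a *\<^sub>C x + a *\<^sub>C y"
    and scaleC_add_left: "(a + b) *\<^sub>C x = a *\<^sub>C x + b *\<^sub>C x"
    and scaleC_scaleC: "a *\<^sub>C b *\<^sub>C x = (a * b) *\<^sub>C x"
    and scaleC_one: "1 *\<^sub>C x = x"
    and scaleR_scaleC: "r *\<^sub>R x = complex_of_real r *\<^sub>C x"
    and norm_scaleC: "norm (a *\<^sub>C x) = cmod a * norm x"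

instantiation complex :: complex_banach
begin

definition scaleC_complex :: "complex \<Rightarrow> complex \<Rightarrow> complex"
  where "scaleC_complex a x = a * x"

instance
  by standard (simp_all add: scaleC_complex_def algebra_simps norm_mult scaleR_conv_of_real)

end

definition bounded_clinear :: "('a::complex_banach \<Rightarrow> 'b::complex_banach) \<Rightarrow> bool"
  where "bounded_clinear f \<longleftrightarrow> bounded_linear f \<and> (\<forall>c x. f (c *\<^sub>C x) = c *\<^sub>C f x)"

definition cholomorphic_on :: "'a::complex_banach set \<Rightarrow> ('a \<Rightarrow> 'b::complex_banach) \<Rightarrow> bool"
  where "cholomorphic_on S f \<longleftrightarrow> (\<forall>z\<in>S. \<exists>D. bounded_clinear D \<and> (f has_derivative D) (at z))"

text \<open>The Frechet derivative as a map into the normed space of bounded operators, so that it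
  can be iterated: \<open>fderiv (fderiv F)\<close> is the second Frechet derivative, and so on.
  The operators are bounded real-linear ones. For a holomorphic map the derivative at a point is
  complex-linear, and the complex-linear operators form a closed subspace with the same norm;
  hence the iterated derivatives are the usual complex ones.
  Maps on the unit ball are total functions whose values outside the ball are irrelevant; the
  derivative is only used at points of the open ball.\<close>

definition fderiv ::
  "('a::real_normed_vector \<Rightarrow> 'b::real_normed_vector) \<Rightarrow> 'a \<Rightarrow> 'a \<Rightarrow>\<^sub>L 'b"
  where "fderiv F z = Blinfun (frechet_derivative F (at z))"

definition support_functionals :: "'a::complex_banach \<Rightarrow> ('a \<Rightarrow> complex) set"
  where "support_functionals z =
    {l. bounded_clinear l \<and> l z = complex_of_real (norm z) \<and> onorm l = 1}"

definition normalized :: "('a::complex_banach \<Rightarrow> 'a) \<Rightarrow> bool"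
  where "normalized F \<longleftrightarrow>
    cholomorphic_on (ball 0 1) F \<and> F 0 = 0 \<and> fderiv F 0 = id_blinfun"

definition locally_biholomorphic :: "('a::complex_banach \<Rightarrow> 'a) \<Rightarrow> bool"
  where "locally_biholomorphic F \<longleftrightarrow>
    cholomorphic_on (ball 0 1) F \<and>
    (\<forall>z\<in>ball 0 1. bij (blinfun_apply (fderiv F z)) \<and>
                    bounded_clinear (inv (blinfun_apply (fderiv F z))))"

definition Phi :: "real \<Rightarrow> complex \<Rightarrow> complex"
  where "Phi \<alpha> \<zeta> = (1 + (1 - 2 * complex_of_real \<alpha>) * \<zeta>) / (1 - \<zeta>)"

text \<open>The class of starlike mappings of order \<open>\<alpha>\<close>, for \<open>0 \<le> \<alpha> < 1\<close>. In the case \<open>\<alpha> = 0\<close>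
  the convention \<open>x / 0 = 0\<close> is harmless, because \<open>0\<close> is not a value of \<^term>\<open>Phi 0\<close> on the
  open unit disk.\<close>

definition starlike_of_order :: "real \<Rightarrow> ('a::complex_banach \<Rightarrow> 'a) \<Rightarrow> bool"
  where "starlike_of_order \<alpha> F \<longleftrightarrow>
    normalized F \<and> locally_biholomorphic F \<and>
    (\<forall>z\<in>ball 0 1 - {0}. \<forall>l\<in>support_functionals z.
       (let w = l (inv (blinfun_apply (fderiv F z)) (F z)) in
        if \<alpha> = 0 then complex_of_real (norm z) / w \<in> Phi 0 ` ball 0 1
        else cmod (w / complex_of_real (norm z) - 1 / (2 * complex_of_real \<alpha>)) < 1 / (2 * \<alpha>)))"

definition A2 :: "('a::complex_banach \<Rightarrow> 'a) \<Rightarrow> ('a \<Rightarrow> complex) \<Rightarrow> 'a \<Rightarrow> complex"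
  where "A2 F l z = l (fderiv (fderiv F) 0 z z) / (fact 2 * complex_of_real (norm z) ^ 2)"

definition A3 :: "('a::complex_banach \<Rightarrow> 'a) \<Rightarrow> ('a \<Rightarrow> complex) \<Rightarrow> 'a \<Rightarrow> complex"
  where "A3 F l z =
    l (fderiv (fderiv (fderiv F)) 0 z z z) / (fact 3 * complex_of_real (norm z) ^ 3)"

definition A4 :: "('a::complex_banach \<Rightarrow> 'a) \<Rightarrow> ('a \<Rightarrow> complex) \<Rightarrow> 'a \<Rightarrow> complex"
  where "A4 F l z =
    l (fderiv (fderiv (fderiv (fderiv F))) 0 z z z z) / (fact 4 * complex_of_real (norm z) ^ 4)"

end

theory Submission
  imports Defs "HOL-Complex_Analysis.Complex_Analysis"
begin

text \<open>Everything reduces to functions of one complex variable. Normalize \<open>z\<close> to a unit vector \<open>u\<close> with a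
  support functional \<open>l\<close>, and put \<open>h s = f (s u)\<close>. Since \<open>l u = 1\<close>, the function \<open>l (F (s u))\<close> is
  \<open>s h s\<close>, so that \<open>A\<^sub>2, A\<^sub>3, A\<^sub>4\<close> are the Taylor coefficients of \<open>h\<close> at \<open>s, s\<^sup>2, s\<^sup>3\<close>
  (\<open>A_eq_taylor\<close>). The operator \<open>DF(z)\<close> maps the line through \<open>z\<close> to itself, so
  \<open>[DF(z)]\<^sup>-\<^sup>1 F(z)\<close> is an explicit multiple of \<open>z\<close>, and starlikeness of \<open>F\<close> becomes
  \<open>Re (1 + s h'/h) > \<alpha>\<close> on the disk (\<open>starlike_condition_multiplier\<close>).

  With \<open>\<beta> = 1 - \<alpha>\<close> this means \<open>s h' (1 - \<omega>) = 2 \<beta> \<omega> h\<close> for a Schwarz function \<open>\<omega>\<close>. Comparing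
  coefficients expresses the \<open>A\<^sub>k\<close> by the first three coefficients of \<open>\<omega>\<close>, and two steps of the Schur
  algorithm parametrize those by numbers of modulus at most 1 (\<open>Schwarz_coefficients\<close>). The
  quantity to be bounded is a symmetric Toeplitz determinant, and it factors as
  \<open>(A\<^sub>2 - A\<^sub>4) (A\<^sub>2\<^sup>2 + A\<^sub>2 A\<^sub>4 - 2 A\<^sub>3\<^sup>2)\<close>. The first factor is bounded by
  \<open>\<bar>A\<^sub>2\<bar> + \<bar>A\<^sub>4\<bar>\<close> through the Caratheodory inequalities, the second one by the triangle
  inequality and monotonicity in the Schur parameters (\<open>second_factor_bound\<close>). Both bounds are
  attained for \<open>\<omega> s = \<i> s\<close>, where \<open>A\<^sub>2\<close> and \<open>A\<^sub>4\<close> are imaginary of opposite sign and \<open>A\<^sub>3\<close> is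
  real; this is the mapping \<open>z (1 - \<i> l(z))\<^bsup>-2\<beta>\<^esup>\<close> for a support functional \<open>l\<close>.

  Two pieces of functional analysis stand behind this. The \<open>A\<^sub>k\<close> are defined by iterated Frechet
  derivatives, which agree with the derivatives along the line only if all of them exist; that is
  \<open>cholomorphic_fderiv\<close>, by which the Frechet derivative of a holomorphic map is again holomorphic
  into the space of operators. Its proof transports Cauchy estimates for scalar functions to Banach
  spaces by means of norming functionals, and these come, like the functional in the extremal
  mapping, from the Hahn-Banach theorem (\<open>Hahn_Banach_norming\<close>).\<close>

section \<open>The Hahn-Banach theorem\<close>

definition sublinear :: "('a::real_vector \<Rightarrow> real) \<Rightarrow> bool"
  where "sublinear p \<longleftrightarrow>
    (\<forall>x y. p (x + y) \<le> p x + p y) \<and> (\<forall>t x. t \<ge> 0 \<longrightarrow> p (t *\<^sub>R x) = t * p x)"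

lemma sublinear_zero: "sublinear p \<Longrightarrow> p 0 = 0"
  unfolding sublinear_def by (metis mult_zero_left order_refl scaleR_zero_left)

lemma sublinear_bound_below:
  assumes "sublinear p" shows "- p (- x) \<le> p x"
proof -
  have "p (x + (- x)) \<le> p x + p (- x)"
    using assms unfolding sublinear_def by blast
  then show ?thesis
    using sublinear_zero[OF assms] by simp
qed

text \<open>A chain of sublinear functionals is directed, so this provides lower bounds of chains for Zorn's lemma.\<close>

lemma sublinear_Inf_directed:
  fixes P :: "('a::real_vector \<Rightarrow> real) set"
  assumes ne: "P \<noteq> {}"
    and hom: "\<And>p t x. p \<in> P \<Longrightarrow> t \<ge> 0 \<Longrightarrow> p (t *\<^sub>R x) = t * p x"
    and bdd: "\<And>x. bdd_below ((\<lambda>p. p x) ` P)"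
    and dir: "\<And>p q x y. p \<in> P \<Longrightarrow> q \<in> P \<Longrightarrow> \<exists>r\<in>P. r (x + y) \<le> p x + q y"
  shows "sublinear (\<lambda>x. INF p\<in>P. p x)"
  unfolding sublinear_def
proof (intro conjI allI impI)
  fix x y
  show "(INF p\<in>P. p (x + y)) \<le> (INF p\<in>P. p x) + (INF p\<in>P. p y)"
  proof -
    have "(INF p\<in>P. p (x + y)) - p x \<le> (INF q\<in>P. q y)" if "p \<in> P" for p
    proof (rule cINF_greatest[OF ne])
      fix q assume "q \<in> P"
      with dir[OF that this, of x y] obtain r where "r \<in> P" "r (x + y) \<le> p x + q y" by blast
      with cINF_lower[OF bdd[of "x + y"], of r]
      show "(INF p\<in>P. p (x + y)) - p x \<le> q y" by linarith
    qed
    then have "(INF p\<in>P. p (x + y)) - (INF q\<in>P. q y) \<le> (INF p\<in>P. p x)"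
      by (intro cINF_greatest[OF ne]) (simp add: algebra_simps)
    then show ?thesis by linarith
  qed
next
  fix t :: real and x
  assume t: "t \<ge> 0"
  have scaled: "(INF p\<in>P. p (t *\<^sub>R x)) = (INF p\<in>P. t * p x)"
    using hom t by (intro arg_cong[where f=Inf] image_cong) auto
  show "(INF p\<in>P. p (t *\<^sub>R x)) = t * (INF p\<in>P. p x)"
  proof (cases "t = 0")
    case True
    with ne scaled show ?thesis by simp
  next
    case False
    with t have t: "t > 0" by simp
    have "(INF p\<in>P. t * p x) \<le> t * (INF p\<in>P. p x)"
    proof -
      have "(INF p\<in>P. t * p x) / t \<le> (INF p\<in>P. p x)"
      proof (rule cINF_greatest[OF ne])
        fix p assume p: "p \<in> P"
        have "bdd_below ((\<lambda>p. t * p x) ` P)"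
        proof -
          have "(\<lambda>p. t * p x) ` P = (\<lambda>p. p (t *\<^sub>R x)) ` P"
            using hom t by (intro image_cong) auto
          then show ?thesis using bdd[of "t *\<^sub>R x"] by simp
        qed
        from cINF_lower[OF this p] show "(INF p\<in>P. t * p x) / t \<le> p x"
          using t by (simp add: divide_le_eq mult.commute)
      qed
      then show ?thesis using t by (simp add: divide_le_eq mult.commute)
    qed
    moreover have "t * (INF p\<in>P. p x) \<le> (INF p\<in>P. t * p x)"
      using t cINF_lower[OF bdd[of x]] by (intro cINF_greatest[OF ne]) simp
    ultimately show ?thesis using scaled by simp
  qed
qed

text \<open>The greatest sublinear functional below \<open>p\<close> that takes a value at most \<open>- p y\<close> at \<open>- y\<close>. It forces
  a minimal functional to be odd, and it forces a linear functional below it to attain \<open>p y\<close> at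
  \<open>y\<close>.\<close>

definition sublinear_shift :: "('a::real_vector \<Rightarrow> real) \<Rightarrow> 'a \<Rightarrow> 'a \<Rightarrow> real"
  where "sublinear_shift p y x = (INF t\<in>{0..}. p (x + t *\<^sub>R y) - t * p y)"

lemma sublinear_shift:
  fixes p :: "'a::real_vector \<Rightarrow> real"
  assumes p: "sublinear p"
  shows "sublinear (sublinear_shift p y)"
    and "sublinear_shift p y x \<le> p x"
    and "sublinear_shift p y (- y) \<le> - p y"
proof -
  have add: "p (u + v) \<le> p u + p v" for u v
    using p unfolding sublinear_def by blast
  have mult: "t \<ge> 0 \<Longrightarrow> p (t *\<^sub>R u) = t * p u" for t u
    using p unfolding sublinear_def by blast
  have bdd: "bdd_below ((\<lambda>t. p (x + t *\<^sub>R y) - t * p y) ` {0..})" for x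
  proof (rule bdd_belowI2)
    fix t :: real assume "t \<in> {0..}"
    then show "- p (- x) \<le> p (x + t *\<^sub>R y) - t * p y"
      using add[of "x + t *\<^sub>R y" "- x"] mult[of t y] by simp
  qed
  have lower: "sublinear_shift p y x \<le> p (x + t *\<^sub>R y) - t * p y" if "t \<ge> 0" for t x
    unfolding sublinear_shift_def using cINF_lower[OF bdd[of x], of t] that by simp
  show "sublinear_shift p y x \<le> p x"
    using lower[of 0 x] by simp
  show "sublinear_shift p y (- y) \<le> - p y"
    using lower[of 1 "- y"] sublinear_zero[OF p] by simp
  show "sublinear (sublinear_shift p y)"
    unfolding sublinear_def
  proof (intro conjI allI impI)
    fix u v
    have le: "sublinear_shift p y (u + v) - (p (u + s *\<^sub>R y) - s * p y) \<le> p (v + t *\<^sub>R y) - t * p y"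
      if "s \<ge> 0" "t \<ge> 0" for s t
      using lower[of "s + t" "u + v"] add[of "u + s *\<^sub>R y" "v + t *\<^sub>R y"] that
      by (simp add: algebra_simps)
    have "sublinear_shift p y (u + v) - (p (u + s *\<^sub>R y) - s * p y) \<le> sublinear_shift p y v"
      if "s \<ge> 0" for s
      unfolding sublinear_shift_def[of p y v] using le[OF that] by (intro cINF_greatest) auto
    then have "sublinear_shift p y (u + v) - sublinear_shift p y v \<le> sublinear_shift p y u"
      unfolding sublinear_shift_def[of p y u]
      by (intro cINF_greatest) (auto simp: algebra_simps)
    then show "sublinear_shift p y (u + v) \<le> sublinear_shift p y u + sublinear_shift p y v"
      by linarith
  next
    fix t :: real and u assume t0: "t \<ge> 0"
    show "sublinear_shift p y (t *\<^sub>R u) = t * sublinear_shift p y u"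
    proof (cases "t = 0")
      case True
      have "0 \<le> sublinear_shift p y 0"
        unfolding sublinear_shift_def using mult by (intro cINF_greatest) auto
      with True lower[of 0 0] show ?thesis
        using sublinear_zero[OF p] by simp
    next
      case False
      with t0 have t: "t > 0" by simp
      have scale: "p (t *\<^sub>R u + (t * s) *\<^sub>R y) - (t * s) * p y = t * (p (u + s *\<^sub>R y) - s * p y)" for s
        using mult[of t "u + s *\<^sub>R y"] t by (simp add: algebra_simps)
      have "sublinear_shift p y (t *\<^sub>R u) / t \<le> sublinear_shift p y u"
        unfolding sublinear_shift_def[of p y u]
      proof (rule cINF_greatest)
        fix s :: real assume "s \<in> {0..}"
        then have "sublinear_shift p y (t *\<^sub>R u) \<le> t * (p (u + s *\<^sub>R y) - s * p y)"
          using lower[of "t * s" "t *\<^sub>R u"] scale[of s] t by simp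
        then show "sublinear_shift p y (t *\<^sub>R u) / t \<le> p (u + s *\<^sub>R y) - s * p y"
          using t by (simp add: divide_le_eq mult.commute)
      qed simp
      moreover have "t * sublinear_shift p y u \<le> sublinear_shift p y (t *\<^sub>R u)"
        unfolding sublinear_shift_def[of p y "t *\<^sub>R u"]
      proof (rule cINF_greatest)
        fix s :: real assume "s \<in> {0..}"
        then have "sublinear_shift p y u \<le> p (u + (s / t) *\<^sub>R y) - (s / t) * p y"
          using t by (intro lower) simp
        then have "t * sublinear_shift p y u \<le> t * (p (u + (s / t) *\<^sub>R y) - (s / t) * p y)"
          using t by simp
        then show "t * sublinear_shift p y u \<le> p (t *\<^sub>R u + s *\<^sub>R y) - s * p y"
          using scale[of "s / t"] t by simp
      qed simp
      ultimately show ?thesis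
        using t by (simp add: divide_le_eq mult.commute)
    qed
  qed
qed

text \<open>A minimal sublinear functional coincides with all its shifts and is therefore odd; subadditivity at
  \<open>x, y\<close> and at \<open>- x, - y\<close> then gives additivity.\<close>

lemma sublinear_minimal_linear:
  fixes q :: "'a::real_vector \<Rightarrow> real"
  assumes q: "sublinear q"
    and min: "\<And>p. sublinear p \<Longrightarrow> (\<And>x. p x \<le> q x) \<Longrightarrow> p = q"
  shows "linear q"
proof -
  have odd: "q (- y) = - q y" for y
  proof -
    have "sublinear_shift q y = q"
      using sublinear_shift[OF q] min by blast
    then have "q (- y) \<le> - q y"
      using sublinear_shift(3)[OF q, of y] by simp
    then show ?thesis
      using sublinear_bound_below[OF q, of y] by linarith
  qed
  have add: "q (u + v) \<le> q u + q v" for u v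
    using q unfolding sublinear_def by blast
  have mult: "t \<ge> 0 \<Longrightarrow> q (t *\<^sub>R u) = t * q u" for t u
    using q unfolding sublinear_def by blast
  show ?thesis
  proof (rule linearI)
    fix x y
    show "q (x + y) = q x + q y"
      using add[of x y] add[of "- x" "- y"] odd[of x] odd[of y] odd[of "x + y"] by simp
  next
    fix c :: real and x
    show "q (c *\<^sub>R x) = c *\<^sub>R q x"
      using mult[of c x] mult[of "- c" x] odd[of "c *\<^sub>R x"] by (cases "c \<ge> 0") auto
  qed
qed

lemma sublinear_dominates_linear:
  fixes p :: "'a::real_vector \<Rightarrow> real"
  assumes p: "sublinear p"
  obtains q where "linear q" "\<And>x. q x \<le> p x"
proof -
  define A where "A = {q. sublinear q \<and> (\<forall>x. q x \<le> p x)}"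
  define below where "below = (\<lambda>a b :: 'a \<Rightarrow> real. \<forall>x. b x \<le> a x)"
  have "\<exists>m\<in>A. \<forall>a\<in>A. below m a \<longrightarrow> a = m"
  proof (rule predicate_Zorn)
    show "partial_order_on A (relation_of below A)"
      unfolding relation_of_def partial_order_on_def preorder_on_def refl_on_def trans_def antisym_def
        below_def by (auto intro: order_trans intro!: ext order_antisym)
  next
    fix C assume C: "C \<in> Chains (relation_of below A)"
    then have CA: "C \<subseteq> A"
      unfolding Chains_def relation_of_def by auto
    show "\<exists>u\<in>A. \<forall>a\<in>C. below a u"
    proof (cases "C = {}")
      case True
      with p show ?thesis unfolding A_def by auto
    next
      case False
      have chain: "below q r \<or> below r q" if "q \<in> C" "r \<in> C" for q r
        using C that unfolding Chains_def relation_of_def by auto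
      have bdd: "bdd_below ((\<lambda>q. q x) ` C)" for x
      proof (rule bdd_belowI2)
        fix q assume "q \<in> C"
        then have "sublinear q" "q (- x) \<le> p (- x)"
          using CA unfolding A_def by auto
        then show "- p (- x) \<le> q x"
          using sublinear_bound_below[of q x] by linarith
      qed
      have hom: "t \<ge> 0 \<Longrightarrow> q (t *\<^sub>R x) = t * q x" if "q \<in> C" for q t x
        using that CA unfolding A_def sublinear_def by auto
      have dir: "\<exists>s\<in>C. s (x + y) \<le> q x + r y" if qr: "q \<in> C" "r \<in> C" for q r x y
      proof -
        have add: "q (x + y) \<le> q x + q y" "r (x + y) \<le> r x + r y"
          using qr CA unfolding A_def sublinear_def by auto
        from chain[OF qr] show ?thesis
        proof
          assume "below q r"
          then have "r (x + y) \<le> q x + r y" using add(2) unfolding below_def by (smt (verit))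
          with qr show ?thesis by blast
        next
          assume "below r q"
          then have "q (x + y) \<le> q x + r y" using add(1) unfolding below_def by (smt (verit))
          with qr show ?thesis by blast
        qed
      qed
      define u where "u = (\<lambda>x. INF q\<in>C. q x)"
      have "sublinear u"
        unfolding u_def by (rule sublinear_Inf_directed) (use False hom bdd dir in auto)
      moreover have le: "u x \<le> q x" if "q \<in> C" for q x
        unfolding u_def using cINF_lower[OF bdd that] .
      moreover have "u x \<le> p x" for x
        using False CA le order_trans unfolding A_def by blast
      ultimately show ?thesis
        unfolding A_def below_def by blast
    qed
  qed
  then obtain m where m: "m \<in> A" and min: "\<And>a. a \<in> A \<Longrightarrow> below m a \<Longrightarrow> a = m"
    by blast
  have "linear m"
  proof (rule sublinear_minimal_linear)
    show "sublinear m" using m unfolding A_def by blast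
    fix q :: "'a \<Rightarrow> real" assume "sublinear q" "\<And>x. q x \<le> m x"
    then show "q = m"
      using m by (intro min) (auto simp: A_def below_def intro: order_trans)
  qed
  with m that show ?thesis
    unfolding A_def by blast
qed

text \<open>Domination by the norm shifted at \<open>y\<close>, instead of the norm itself, makes the functional attain its
  norm at \<open>y\<close>.\<close>

lemma Hahn_Banach_real:
  fixes y :: "'a::real_normed_vector"
  obtains r :: "'a \<Rightarrow> real" where "linear r" "\<And>x. r x \<le> norm x" "r y = norm y"
proof -
  have norm: "sublinear (norm :: 'a \<Rightarrow> real)"
    unfolding sublinear_def by (simp add: norm_triangle_ineq)
  obtain r where r: "linear r" "\<And>x. r x \<le> sublinear_shift norm y x"
    using sublinear_dominates_linear[OF sublinear_shift(1)[OF norm]] by blast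
  have le: "r x \<le> norm x" for x
    using r(2)[of x] sublinear_shift(2)[OF norm, of y x] by linarith
  have "r (- y) \<le> - norm y"
    using r(2)[of "- y"] sublinear_shift(3)[OF norm, of y] by linarith
  then have "r y = norm y"
    using le[of y] linear_neg[OF r(1), of y] by simp
  with r(1) le that show thesis by blast
qed

section \<open>Complex functionals and spaces of operators\<close>

lemma scaleC_zero_right [simp]: "a *\<^sub>C (0::'a::complex_banach) = 0"
  by (metis add_cancel_left_left scaleC_add_right)

lemma scaleC_zero_left [simp]: "0 *\<^sub>C (x::'a::complex_banach) = 0"
  by (metis add_cancel_left_left scaleC_add_left)

lemma scaleC_minus_right: "a *\<^sub>C (- x::'a::complex_banach) = - (a *\<^sub>C x)"
  by (metis add.inverse_inverse add_eq_0_iff scaleC_add_right scaleC_zero_right)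

lemma scaleC_minus_left: "(- a) *\<^sub>C (x::'a::complex_banach) = - (a *\<^sub>C x)"
  by (metis add_eq_0_iff scaleC_add_left scaleC_zero_left add.inverse_inverse)

lemma scaleC_diff_right: "a *\<^sub>C (x - y::'a::complex_banach) = a *\<^sub>C x - a *\<^sub>C y"
  using scaleC_add_right[of a x "- y"] by (simp add: scaleC_minus_right)

lemma scaleC_diff_left: "(a - b) *\<^sub>C (x::'a::complex_banach) = a *\<^sub>C x - b *\<^sub>C x"
  using scaleC_add_left[of a "- b" x] by (simp add: scaleC_minus_left)

lemma bounded_bilinear_scaleC:
  "bounded_bilinear (scaleC :: complex \<Rightarrow> 'a::complex_banach \<Rightarrow> 'a)"
proof
  fix a b :: complex and x y :: 'a and r :: real
  show "(a + b) *\<^sub>C x = a *\<^sub>C x + b *\<^sub>C x" by (rule scaleC_add_left)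
  show "a *\<^sub>C (x + y) = a *\<^sub>C x + a *\<^sub>C y" by (rule scaleC_add_right)
  show "(r *\<^sub>R a) *\<^sub>C x = r *\<^sub>R a *\<^sub>C x" "a *\<^sub>C r *\<^sub>R x = r *\<^sub>R a *\<^sub>C x"
    unfolding scaleR_conv_of_real by (simp_all add: scaleR_scaleC scaleC_scaleC mult.commute)
  show "\<exists>K. \<forall>a (x::'a). norm (a *\<^sub>C x) \<le> norm a * norm x * K"
    by (intro exI[of _ 1]) (simp add: norm_scaleC)
qed

lemmas bounded_linear_scaleC_left = bounded_bilinear.bounded_linear_left[OF bounded_bilinear_scaleC]
lemmas bounded_linear_scaleC_right = bounded_bilinear.bounded_linear_right[OF bounded_bilinear_scaleC]

lemma bounded_clinear_bounded_linear: "bounded_clinear f \<Longrightarrow> bounded_linear f"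
  by (simp add: bounded_clinear_def)

lemma bounded_clinear_cmult:
  fixes f :: "'a::complex_banach \<Rightarrow> complex"
  shows "bounded_clinear f \<Longrightarrow> f (c *\<^sub>C x) = c * f x"
  by (simp add: bounded_clinear_def scaleC_complex_def)

text \<open>A complex functional is recovered from its real part \<open>r\<close> as \<open>r x - \<i> r (\<i> x)\<close>, and a rotation of
  the argument turns the bound for \<open>r\<close> into the bound for the modulus.\<close>

theorem Hahn_Banach_norming:
  fixes y :: "'a::complex_banach"
  obtains l :: "'a \<Rightarrow> complex"
  where "bounded_clinear l" "\<And>x. cmod (l x) \<le> norm x" "l y = complex_of_real (norm y)"
proof -
  obtain r :: "'a \<Rightarrow> real" where r: "linear r" "\<And>x. r x \<le> norm x" "r y = norm y"
    using Hahn_Banach_real[of y] by blast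
  define l where "l x = Complex (r x) (- r (\<i> *\<^sub>C x))" for x
  have Re_l: "Re (l x) = r x" for x by (simp add: l_def)
  have add: "l (x + x') = l x + l x'" for x x'
    using r(1) by (simp add: l_def linear_add scaleC_add_right complex_eq_iff)
  have real: "r (complex_of_real t *\<^sub>C x) = t * r x" for t x
    using linear_cmul[OF r(1), of t x] by (simp add: scaleR_scaleC)
  have mult: "l (c *\<^sub>C x) = c * l x" for c x
  proof -
    have "c *\<^sub>C x = complex_of_real (Re c) *\<^sub>C x + complex_of_real (Im c) *\<^sub>C \<i> *\<^sub>C x"
      by (metis complex_eq mult.commute scaleC_add_left scaleC_scaleC)
    moreover have "\<i> *\<^sub>C c *\<^sub>C x = complex_of_real (Re c) *\<^sub>C \<i> *\<^sub>C x + complex_of_real (- Im c) *\<^sub>C x"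
      by (simp add: scaleC_scaleC complex_eq_iff flip: scaleC_add_left)
        (rule arg_cong[where f="\<lambda>a. a *\<^sub>C x"], simp add: complex_eq_iff)
    ultimately have "r (c *\<^sub>C x) = Re c * r x + Im c * r (\<i> *\<^sub>C x)"
      "r (\<i> *\<^sub>C c *\<^sub>C x) = Re c * r (\<i> *\<^sub>C x) - Im c * r x"
      by (simp_all only: linear_add[OF r(1)] real)
    then show ?thesis
      by (simp add: l_def complex_eq_iff)
  qed
  have bound: "cmod (l x) \<le> norm x" for x
  proof (cases "l x = 0")
    case False
    define c where "c = cnj (l x) / complex_of_real (cmod (l x))"
    have "cmod c = 1" using False by (simp add: c_def norm_divide)
    have "c * l x = complex_of_real (cmod (l x))"
      using False by (simp add: c_def complex_norm_square[symmetric] power2_eq_square mult.commute)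
    then have "cmod (l x) = r (c *\<^sub>C x)"
      by (metis Re_complex_of_real Re_l mult)
    also have "\<dots> \<le> norm (c *\<^sub>C x)" by (rule r(2))
    also have "\<dots> = norm x" using \<open>cmod c = 1\<close> by (simp add: norm_scaleC)
    finally show ?thesis .
  qed simp
  have "bounded_linear l"
  proof (rule bounded_linear_intro[where K=1])
    show "l (t *\<^sub>R x) = t *\<^sub>R l x" for t x
      using mult by (simp add: scaleR_scaleC scaleC_complex_def)
  qed (use add bound in auto)
  then have "bounded_clinear l"
    using mult by (simp add: bounded_clinear_def scaleC_complex_def)
  moreover have "l y = complex_of_real (norm y)"
  proof -
    have "Re (l y) = norm y" by (simp add: Re_l r(3))
    moreover have "(Re (l y))\<^sup>2 + (Im (l y))\<^sup>2 \<le> (norm y)\<^sup>2"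
      using power_mono[OF bound[of y], of 2] by (simp add: cmod_power2)
    ultimately show ?thesis
      by (simp add: complex_eq_iff)
  qed
  ultimately show thesis
    using that bound by blast
qed

lemma support_functional_bound:
  assumes "l \<in> support_functionals z"
  shows "cmod (l x) \<le> norm x"
  using onorm[of l x] assms
  by (simp add: support_functionals_def bounded_clinear_def)

lemma support_functionalsI:
  assumes "bounded_clinear l" "\<And>x. cmod (l x) \<le> norm x" "l z = complex_of_real (norm z)" "z \<noteq> 0"
  shows "l \<in> support_functionals z"
proof -
  have "onorm l \<le> 1"
    using assms(2) by (intro onorm_bound) auto
  moreover have "1 \<le> onorm l"
    using onorm[of l z] assms by (simp add: bounded_clinear_def)
  ultimately show ?thesis
    using assms by (simp add: support_functionals_def)
qed

text \<open>With the pointwise complex structure the operators form a complex Banach space themselves. Facts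
  about holomorphic maps into an arbitrary complex Banach space then apply to \<open>fderiv F\<close>, to
  \<open>fderiv (fderiv F)\<close>, and so on.\<close>

instantiation blinfun :: (real_normed_vector, complex_banach) complex_banach
begin

lift_definition scaleC_blinfun :: "complex \<Rightarrow> 'a \<Rightarrow>\<^sub>L 'b \<Rightarrow> 'a \<Rightarrow>\<^sub>L 'b"
  is "\<lambda>c A x. c *\<^sub>C A x"
  by (rule bounded_linear_compose[OF bounded_linear_scaleC_right])

instance
proof
  fix a b :: complex and A B :: "'a \<Rightarrow>\<^sub>L 'b" and r :: real
  show "a *\<^sub>C (A + B) = a *\<^sub>C A + a *\<^sub>C B"
    by transfer (simp add: scaleC_add_right)
  show "(a + b) *\<^sub>C A = a *\<^sub>C A + b *\<^sub>C A"
    by transfer (simp add: scaleC_add_left)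
  show "a *\<^sub>C b *\<^sub>C A = (a * b) *\<^sub>C A"
    by transfer (simp add: scaleC_scaleC)
  show "1 *\<^sub>C A = A"
    by transfer (simp add: scaleC_one)
  show "r *\<^sub>R A = complex_of_real r *\<^sub>C A"
    by transfer (simp add: scaleR_scaleC)
  show "norm (a *\<^sub>C A) = cmod a * norm A"
  proof transfer
    fix a :: complex and f :: "'a \<Rightarrow> 'b" assume "bounded_linear f"
    have "onorm (\<lambda>x. a *\<^sub>C f x) = onorm (\<lambda>x. cmod a *\<^sub>R f x)"
      by (simp add: onorm_def norm_scaleC)
    then show "onorm (\<lambda>x. a *\<^sub>C f x) = cmod a * onorm f"
      using onorm_scaleR[OF \<open>bounded_linear f\<close>, of "cmod a"] by simp
  qed
qed

end

lemma blinfun_scaleC_apply: "blinfun_apply (c *\<^sub>C A) x = c *\<^sub>C blinfun_apply A x"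
  by transfer simp

section \<open>Holomorphic maps are infinitely differentiable\<close>

text \<open>Cauchy's inequalities on circles inside the disk bound the first two derivatives by the supremum
  \<open>M\<close>; the constants are those of circles of radius \<open>R/2\<close> and \<open>R/4\<close>.\<close>

lemma Cauchy_remainder:
  assumes hol: "g holomorphic_on ball 0 R" and R: "R > 0"
    and bound: "\<And>s. s \<in> ball 0 R \<Longrightarrow> cmod (g s) \<le> M"
  shows "cmod (deriv g 0) \<le> 2 * M / R"
    and "cmod s \<le> R / 2 \<Longrightarrow> cmod (g s - g 0 - s * deriv g 0) \<le> 32 * M / R\<^sup>2 * (cmod s)\<^sup>2"
proof -
  have higher: "cmod ((deriv ^^ n) g x) \<le> fact n * M / r ^ n"
    if "r > 0" "cmod x + r < R" for n x r
  proof -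
    have sub: "cball x r \<subseteq> ball 0 R"
    proof
      fix y assume "y \<in> cball x r"
      then have "cmod (y - x) \<le> r" by (simp add: dist_norm norm_minus_commute)
      then show "y \<in> ball 0 R"
        using norm_triangle_ineq[of x "y - x"] that by simp
    qed
    then have "g holomorphic_on ball x r"
      by (intro holomorphic_on_subset[OF hol]) (use ball_subset_cball in blast)
    moreover have "continuous_on (cball x r) g"
      using hol sub holomorphic_on_imp_continuous_on continuous_on_subset by blast
    ultimately show ?thesis
    proof (rule Cauchy_inequality)
      fix y assume "cmod (x - y) = r"
      then have "y \<in> cball x r" by (simp add: dist_norm)
      then show "cmod (g y) \<le> M" using bound sub by blast
    qed (use that in simp)
  qed
  show "cmod (deriv g 0) \<le> 2 * M / R"
    using higher[of "R/2" 0 1] R by (simp add: mult.commute)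
  assume s: "cmod s \<le> R / 2"
  have "cmod ((deriv ^^ 0) g s - (\<Sum>i\<le>1. (deriv ^^ i) g 0 * (s - 0) ^ i / fact i))
      \<le> 32 * M / R\<^sup>2 * cmod (s - 0) ^ Suc 1 / fact 1"
  proof (rule complex_Taylor[where S="cball 0 (R/2)"])
    show "((deriv ^^ i) g has_field_derivative (deriv ^^ Suc i) g x) (at x within cball 0 (R / 2))"
      if "x \<in> cball 0 (R / 2)" for i x
    proof -
      have "x \<in> ball 0 R" using that R by simp
      moreover have "(deriv ^^ i) g holomorphic_on ball 0 R"
        by (intro holomorphic_higher_deriv hol) simp
      ultimately show ?thesis
        using holomorphic_derivI[of "(deriv ^^ i) g" "ball 0 R" x] has_field_derivative_at_within
        by auto
    qed
    show "cmod ((deriv ^^ Suc 1) g x) \<le> 32 * M / R\<^sup>2" if "x \<in> cball 0 (R / 2)" for x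
      using higher[of "R/4" x 2] that R by (simp add: numeral_2_eq_2 power2_eq_square divide_simps)
  qed (use s R in auto)
  then show "cmod (g s - g 0 - s * deriv g 0) \<le> 32 * M / R\<^sup>2 * (cmod s)\<^sup>2"
    by (simp add: power2_eq_square algebra_simps)
qed

text \<open>For maps into a space of operators only the functionals \<open>A \<mapsto> l (A v)\<close> are known to give holomorphic
  functions. They need not exhaust the dual space, but they determine the norm, and that is what
  the estimates use.\<close>

definition norming :: "('a::complex_banach \<Rightarrow> complex) set \<Rightarrow> bool"
  where "norming \<Lambda> \<longleftrightarrow>
    (\<forall>l\<in>\<Lambda>. bounded_clinear l) \<and>
    (\<forall>y C. (\<forall>l\<in>\<Lambda>. cmod (l y) \<le> C) \<longrightarrow> norm y \<le> C) \<and> (\<forall>l\<in>\<Lambda>. \<forall>y. cmod (l y) \<le> norm y)"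

lemma norming_dual:
  "norming {l :: 'a::complex_banach \<Rightarrow> complex. bounded_clinear l \<and> (\<forall>x. cmod (l x) \<le> norm x)}"
  unfolding norming_def
proof (intro conjI allI impI)
  fix y :: 'a and C
  assume le: "\<forall>l\<in>{l. bounded_clinear l \<and> (\<forall>x. cmod (l x) \<le> norm x)}. cmod (l y) \<le> C"
  obtain l where "bounded_clinear l" "\<And>x. cmod (l x) \<le> norm x" "l y = complex_of_real (norm y)"
    using Hahn_Banach_norming[of y] by blast
  then have "cmod (l y) \<le> C" "cmod (l y) = norm y" using le by auto
  then show "norm y \<le> C" by simp
qed auto

lemma bounded_clinear_apply:
  assumes "bounded_clinear l"
  shows "bounded_clinear (\<lambda>A. l (blinfun_apply A v))"
  using assms bounded_linear_compose[OF _ blinfun.bounded_linear_left, of l v]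
  by (simp add: bounded_clinear_def blinfun_scaleC_apply)

lemma norming_blinfun:
  assumes "norming \<Lambda>"
  shows "norming {\<lambda>A :: 'a::complex_banach \<Rightarrow>\<^sub>L 'b::complex_banach. l (A v) | l v. l \<in> \<Lambda> \<and> norm v \<le> 1}"
    (is "norming ?\<Lambda>")
  unfolding norming_def
proof (intro conjI ballI allI impI)
  fix m assume "m \<in> ?\<Lambda>"
  then obtain l v where m: "m = (\<lambda>A. l (blinfun_apply A v))" and l: "l \<in> \<Lambda>" and v: "norm v \<le> 1"
    by blast
  have cl: "bounded_clinear l" using assms l by (simp add: norming_def)
  from bounded_clinear_apply[OF cl] show "bounded_clinear m" unfolding m .
  fix A
  have "cmod (l (blinfun_apply A v)) \<le> norm (blinfun_apply A v)"
    using assms l by (simp add: norming_def)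
  also have "\<dots> \<le> norm A * norm v" by (rule norm_blinfun)
  also have "\<dots> \<le> norm A" using v by (simp add: mult_left_le)
  finally show "cmod (m A) \<le> norm A" unfolding m .
next
  fix A :: "'a \<Rightarrow>\<^sub>L 'b" and C
  assume le: "\<forall>m\<in>?\<Lambda>. cmod (m A) \<le> C"
  have norm_le: "norm (blinfun_apply A v) \<le> C" if "norm v \<le> 1" for v
  proof -
    have "\<forall>l\<in>\<Lambda>. cmod (l (blinfun_apply A v)) \<le> C"
    proof
      fix l assume "l \<in> \<Lambda>"
      then have "(\<lambda>A. l (blinfun_apply A v)) \<in> ?\<Lambda>" using that by blast
      with le show "cmod (l (blinfun_apply A v)) \<le> C" by (rule bspec)
    qed
    with assms show ?thesis by (simp add: norming_def)
  qed
  show "norm A \<le> C"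
  proof (rule norm_blinfun_bound)
    show "0 \<le> C" using norm_le[of 0] by simp
    fix x
    show "norm (blinfun_apply A x) \<le> C * norm x"
    proof (cases "x = 0")
      case False
      have "norm (blinfun_apply A (x /\<^sub>R norm x)) \<le> C"
        using False by (intro norm_le) simp
      then show ?thesis
        using False by (simp add: blinfun.scaleR_right divide_simps mult.commute)
    qed simp
  qed
qed

text \<open>The scalar remainder bound is uniform over the norming functionals. Hence the difference quotients
  form a Cauchy sequence, and their limit inherits the bound.\<close>

lemma weak_Cauchy_remainder:
  fixes E :: "complex \<Rightarrow> 'a::complex_banach"
  assumes \<Lambda>: "norming \<Lambda>" and R: "R > 0"
    and hol: "\<And>l. l \<in> \<Lambda> \<Longrightarrow> (\<lambda>s. l (E s)) holomorphic_on ball 0 R"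
    and bound: "\<And>s. s \<in> ball 0 R \<Longrightarrow> norm (E s) \<le> M"
  obtains d where
    "\<And>s. cmod s \<le> R / 2 \<Longrightarrow> norm (E s - E 0 - s *\<^sub>C d) \<le> 32 * M / R\<^sup>2 * (cmod s)\<^sup>2"
proof -
  define K where "K = 32 * M / R\<^sup>2"
  have "0 \<le> M" using order_trans[OF norm_ge_zero bound[of 0]] R by simp
  then have K: "K \<ge> 0" by (simp add: K_def)
  have lin: "bounded_linear l" and cl: "bounded_clinear l"
    and dominated: "\<And>y. cmod (l y) \<le> norm y" if "l \<in> \<Lambda>" for l
    using \<Lambda> that by (auto simp: norming_def bounded_clinear_def)
  have rem: "cmod (l (E s) - l (E 0) - s * deriv (\<lambda>s. l (E s)) 0) \<le> K * (cmod s)\<^sup>2"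
    if "l \<in> \<Lambda>" "cmod s \<le> R / 2" for l s
    unfolding K_def
    using bound dominated[OF that(1)] order_trans
    by (intro Cauchy_remainder(2)[OF hol[OF that(1)] R _ that(2)]) blast
  define t where "t n = R / 2 * inverse (real (Suc n))" for n
  have t: "0 < t n" "t n \<le> R / 2" for n
    using R by (auto simp: t_def divide_simps)
  have t_lim: "t \<longlonglongrightarrow> 0"
    unfolding t_def using tendsto_mult_right_zero[OF LIMSEQ_inverse_real_of_nat] by simp
  define Q where "Q n = complex_of_real (inverse (t n)) *\<^sub>C (E (complex_of_real (t n)) - E 0)" for n
  have Q: "cmod (l (Q n) - deriv (\<lambda>s. l (E s)) 0) \<le> K * t n" if "l \<in> \<Lambda>" for l n
  proof -
    have "l (Q n) - deriv (\<lambda>s. l (E s)) 0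
        = (l (E (t n)) - l (E 0) - t n * deriv (\<lambda>s. l (E s)) 0) / t n"
      using t[of n] bounded_clinear_cmult[OF cl[OF that]] linear_diff[OF bounded_linear.linear[OF lin[OF that]]]
      by (simp add: Q_def field_simps)
    then have "cmod (l (Q n) - deriv (\<lambda>s. l (E s)) 0) \<le> K * (cmod (t n))\<^sup>2 / t n"
      using rem[OF that, of "t n"] t[of n] by (simp add: norm_divide divide_right_mono)
    then show ?thesis using t[of n] by (simp add: power2_eq_square)
  qed
  have "Cauchy Q"
  proof (rule metric_CauchyI)
    fix e :: real assume e: "e > 0"
    have "(\<lambda>n. K * t n) \<longlonglongrightarrow> 0" using tendsto_mult_right_zero[OF t_lim] by simp
    then have "\<forall>\<^sub>F n in sequentially. K * t n < e / 3"
      using e by (intro order_tendstoD(2)) auto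
    then obtain N where N: "\<And>n. n \<ge> N \<Longrightarrow> K * t n < e / 3"
      unfolding eventually_sequentially by blast
    have "dist (Q m) (Q n) < e" if "m \<ge> N" "n \<ge> N" for m n
    proof -
      have "\<forall>l\<in>\<Lambda>. cmod (l (Q m - Q n)) \<le> 2 * e / 3"
      proof
        fix l assume l: "l \<in> \<Lambda>"
        have "l (Q m - Q n) = (l (Q m) - deriv (\<lambda>s. l (E s)) 0) - (l (Q n) - deriv (\<lambda>s. l (E s)) 0)"
          using linear_diff[OF bounded_linear.linear[OF lin[OF l]]] by simp
        then have "cmod (l (Q m - Q n)) \<le> K * t m + K * t n"
          using Q[OF l, of m] Q[OF l, of n] norm_triangle_ineq4 by (smt (verit))
        then show "cmod (l (Q m - Q n)) \<le> 2 * e / 3"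
          using N[OF that(1)] N[OF that(2)] by simp
      qed
      then have "norm (Q m - Q n) \<le> 2 * e / 3" using \<Lambda> unfolding norming_def by blast
      then show ?thesis using e by (simp add: dist_norm)
    qed
    then show "\<exists>N. \<forall>m\<ge>N. \<forall>n\<ge>N. dist (Q m) (Q n) < e" by blast
  qed
  then obtain d where d: "Q \<longlonglongrightarrow> d" using Cauchy_convergent convergent_def by blast
  have l_d: "l d = deriv (\<lambda>s. l (E s)) 0" if "l \<in> \<Lambda>" for l
  proof -
    have "(\<lambda>n. l (Q n)) \<longlonglongrightarrow> l d" using bounded_linear.tendsto[OF lin[OF that] d] .
    moreover have "(\<lambda>n. l (Q n)) \<longlonglongrightarrow> deriv (\<lambda>s. l (E s)) 0"
    proof (rule Lim_transform2)
      show "(\<lambda>n. deriv (\<lambda>s. l (E s)) 0) \<longlonglongrightarrow> deriv (\<lambda>s. l (E s)) 0" by simp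
      show "(\<lambda>n. deriv (\<lambda>s. l (E s)) 0 - l (Q n)) \<longlonglongrightarrow> 0"
      proof (rule Lim_null_comparison)
        show "\<forall>\<^sub>F n in sequentially. cmod (deriv (\<lambda>s. l (E s)) 0 - l (Q n)) \<le> K * t n"
          using Q[OF that] by (intro always_eventually) (simp add: norm_minus_commute)
        show "(\<lambda>n. K * t n) \<longlonglongrightarrow> 0" using tendsto_mult_right_zero[OF t_lim] by simp
      qed
    qed
    ultimately show ?thesis using LIMSEQ_unique by blast
  qed
  have "norm (E s - E 0 - s *\<^sub>C d) \<le> K * (cmod s)\<^sup>2" if "cmod s \<le> R / 2" for s
  proof -
    have "\<forall>l\<in>\<Lambda>. cmod (l (E s - E 0 - s *\<^sub>C d)) \<le> K * (cmod s)\<^sup>2"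
    proof
      fix l assume l: "l \<in> \<Lambda>"
      have "l (E s - E 0 - s *\<^sub>C d) = l (E s) - l (E 0) - s * l d"
        using linear_diff[OF bounded_linear.linear[OF lin[OF l]]] bounded_clinear_cmult[OF cl[OF l]] by simp
      then show "cmod (l (E s - E 0 - s *\<^sub>C d)) \<le> K * (cmod s)\<^sup>2"
        using rem[OF l that] l_d[OF l] by simp
    qed
    then show ?thesis using \<Lambda> by (simp add: norming_def)
  qed
  then show thesis using that unfolding K_def by blast
qed

definition line_derivative ::
    "('a::complex_banach \<Rightarrow> 'b::complex_banach) \<Rightarrow> 'a \<Rightarrow> 'a \<Rightarrow> 'b \<Rightarrow> bool"
  where "line_derivative E w h d \<longleftrightarrow>
    ((\<lambda>s. inverse s *\<^sub>C (E (w + s *\<^sub>C h) - E w)) \<longlongrightarrow> d) (at (0::complex))"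

lemma line_derivative_unique:
  "line_derivative E w h d \<Longrightarrow> line_derivative E w h d' \<Longrightarrow> d = d'"
  unfolding line_derivative_def by (rule tendsto_unique[OF at_neq_bot])

lemma line_derivative_scale:
  assumes "line_derivative E w h d"
  shows "line_derivative E w (c *\<^sub>C h) (c *\<^sub>C d)"
proof (cases "c = 0")
  case True
  then show ?thesis by (simp add: line_derivative_def)
next
  case False
  have "filterlim (\<lambda>s. s * c) (at 0) (at (0::complex))"
    unfolding filterlim_at using False
    by (auto intro!: tendsto_eq_intros simp: eventually_at_filter)
  with assms have "((\<lambda>s. inverse (s * c) *\<^sub>C (E (w + (s * c) *\<^sub>C h) - E w)) \<longlongrightarrow> d) (at (0::complex))"
    unfolding line_derivative_def by (rule filterlim_compose)
  then have *: "((\<lambda>s. c *\<^sub>C inverse (s * c) *\<^sub>C (E (w + (s * c) *\<^sub>C h) - E w)) \<longlongrightarrow> c *\<^sub>C d) (at (0::complex))"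
    by (rule bounded_linear.tendsto[OF bounded_linear_scaleC_right])
  have "c * inverse (s * c) = inverse s" for s
    using False by simp
  with * show ?thesis
    unfolding line_derivative_def scaleC_scaleC by (simp only:)
qed

lemma line_derivativeI:
  assumes \<epsilon>: "\<epsilon> > 0"
    and rem: "\<And>s. cmod s \<le> \<epsilon> \<Longrightarrow> norm (E (w + s *\<^sub>C h) - E w - s *\<^sub>C d) \<le> K * (cmod s)\<^sup>2"
  shows "line_derivative E w h d"
  unfolding line_derivative_def
proof (rule Lim_transform2)
  show "((\<lambda>s::complex. d) \<longlongrightarrow> d) (at 0)" by simp
  show "((\<lambda>s. d - inverse s *\<^sub>C (E (w + s *\<^sub>C h) - E w)) \<longlongrightarrow> 0) (at 0)"
  proof (rule Lim_null_comparison)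
    have "norm (d - inverse s *\<^sub>C (E (w + s *\<^sub>C h) - E w)) \<le> K * cmod s"
      if "s \<noteq> 0" "cmod s \<le> \<epsilon>" for s
    proof -
      have "d - inverse s *\<^sub>C (E (w + s *\<^sub>C h) - E w)
          = - (inverse s *\<^sub>C (E (w + s *\<^sub>C h) - E w - s *\<^sub>C d))"
        using that by (simp add: scaleC_diff_right scaleC_scaleC scaleC_one)
      then have "norm (d - inverse s *\<^sub>C (E (w + s *\<^sub>C h) - E w)) \<le> inverse (cmod s) * (K * (cmod s)\<^sup>2)"
        using mult_left_mono[OF rem[OF that(2)], of "inverse (cmod s)"]
        by (simp add: norm_scaleC norm_inverse)
      then show ?thesis using that by (simp add: power2_eq_square field_simps)
    qed
    then show "\<forall>\<^sub>F s in at 0. norm (d - inverse s *\<^sub>C (E (w + s *\<^sub>C h) - E w)) \<le> K * cmod s"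
      unfolding eventually_at using \<epsilon> by (intro exI[of _ \<epsilon>]) auto
    show "((\<lambda>s. K * cmod s) \<longlongrightarrow> 0) (at 0)"
      by (auto intro!: tendsto_eq_intros)
  qed
qed

lemma zero_if_norm_le_linear:
  fixes a :: "'a::real_normed_vector"
  assumes "\<epsilon> > 0" and le: "\<And>t. 0 < t \<Longrightarrow> t \<le> \<epsilon> \<Longrightarrow> norm a \<le> C * t"
  shows "a = 0"
proof -
  have "((\<lambda>t. C * t) \<longlongrightarrow> 0) (at_right 0)" by (auto intro!: tendsto_eq_intros)
  moreover have "\<forall>\<^sub>F t in at_right 0. norm a \<le> C * t"
    unfolding eventually_at using assms by (intro exI[of _ \<epsilon>]) auto
  ultimately have "norm a \<le> 0" using tendsto_lowerbound trivial_limit_at_right_real by blast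
  then show ?thesis by simp
qed

text \<open>Directional derivatives depend additively on the direction: the remainder bounds at nearby base
  points make them continuous in the base point, so \<open>E (z + s h + s k) - E z\<close> can be split at
  \<open>w = z + s k\<close>. With \<open>s = t\<^sup>2\<close> the derivatives at \<open>w\<close> and \<open>z\<close> differ by \<open>O(t)\<close> only.\<close>

lemma line_derivative_add:
  fixes E :: "'a::complex_banach \<Rightarrow> 'b::complex_banach"
  assumes \<rho>: "0 < \<rho>" "\<rho> \<le> 1"
    and rem: "\<And>w h s. w \<in> ball z \<rho> \<Longrightarrow> norm h \<le> 1 \<Longrightarrow> cmod s \<le> \<rho> \<Longrightarrow>
        norm (E (w + s *\<^sub>C h) - E w - s *\<^sub>C \<delta> w h) \<le> K * (cmod s)\<^sup>2"
    and lip: "\<And>w h s. w \<in> ball z \<rho> \<Longrightarrow> norm h \<le> 1 \<Longrightarrow> cmod s \<le> \<rho> \<Longrightarrow>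
        norm (E (w + s *\<^sub>C h) - E w) \<le> L * cmod s"
    and hk: "norm h \<le> 1 / 2" "norm k \<le> 1 / 2"
  shows "\<delta> z (h + k) = \<delta> z h + \<delta> z k"
proof -
  have norm_4: "norm (a - b + c - d) \<le> norm a + norm b + norm c + norm d" for a b c d :: 'b
    by norm
  have norm_4': "norm (a + b - c + d) \<le> norm a + norm b + norm c + norm d" for a b c d :: 'b
    by norm
  have "\<delta> z (h + k) - \<delta> z h - \<delta> z k = 0"
  proof (rule zero_if_norm_le_linear)
    fix t :: real assume t: "0 < t" "t \<le> \<rho> / 4"
    have t1: "t < 1" using t \<rho> by linarith
    have tt: "t\<^sup>2 \<le> t" using t(1) t1 by (simp add: power2_eq_square)
    define s where "s = complex_of_real (t\<^sup>2)"
    define w where "w = z + s *\<^sub>C k"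
    have cs: "cmod s = t\<^sup>2" by (simp add: s_def norm_power)
    then have s: "cmod s \<le> \<rho>" using t tt \<rho> by linarith
    have n1: "norm h \<le> 1" "norm k \<le> 1" "norm (h + k) \<le> 1"
      using hk norm_triangle_ineq[of h k] by linarith+
    have z: "z \<in> ball z \<rho>" using \<rho> by simp
    have "norm (s *\<^sub>C k) \<le> t\<^sup>2 * (1 / 2)"
      unfolding norm_scaleC cs using hk by (intro mult_left_mono) simp_all
    then have "norm (s *\<^sub>C k) < \<rho>" using t tt by linarith
    then have w: "w \<in> ball z \<rho>" by (simp add: w_def dist_norm)
    define t' where "t' = complex_of_real t"
    have ct': "cmod t' = t" "cmod t' \<le> \<rho>" using t by (simp_all add: t'_def)
    have w': "z + t' *\<^sub>C h \<in> ball z \<rho>"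
    proof -
      have "norm (t' *\<^sub>C h) \<le> t * (1 / 2)"
        unfolding norm_scaleC ct'(1) using hk t by (intro mult_left_mono) simp_all
      then have "norm (t' *\<^sub>C h) < \<rho>" using t by linarith
      then show ?thesis by (simp add: dist_norm)
    qed
    \<comment> \<open>Continuity in the base point: over the longer step \<open>t\<close> the remainders are \<open>O(t\<^sup>2)\<close>, while the
      base points differ by \<open>O(t\<^sup>2)\<close>.\<close>
    have cont: "t * norm (\<delta> w h - \<delta> z h) \<le> 2 * K * t\<^sup>2 + 2 * L * t\<^sup>2"
    proof -
      have "t' *\<^sub>C (\<delta> w h - \<delta> z h) =
          (E (z + t' *\<^sub>C h) - E z - t' *\<^sub>C \<delta> z h) - (E (w + t' *\<^sub>C h) - E w - t' *\<^sub>C \<delta> w h)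
          + (E (z + t' *\<^sub>C h + s *\<^sub>C k) - E (z + t' *\<^sub>C h)) - (E (z + s *\<^sub>C k) - E z)"
        by (simp add: w_def scaleC_diff_right algebra_simps)
      then have "norm (t' *\<^sub>C (\<delta> w h - \<delta> z h)) \<le>
          K * (cmod t')\<^sup>2 + K * (cmod t')\<^sup>2 + L * cmod s + L * cmod s"
        using rem[OF z n1(1) ct'(2)] rem[OF w n1(1) ct'(2)] lip[OF w' n1(2) s] lip[OF z n1(2) s]
          norm_4[of "E (z + t' *\<^sub>C h) - E z - t' *\<^sub>C \<delta> z h" "E (w + t' *\<^sub>C h) - E w - t' *\<^sub>C \<delta> w h"
            "E (z + t' *\<^sub>C h + s *\<^sub>C k) - E (z + t' *\<^sub>C h)" "E (z + s *\<^sub>C k) - E z"]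
        by simp
      then show ?thesis using ct' cs by (simp add: norm_scaleC)
    qed
    have "s *\<^sub>C (\<delta> z (h + k) - \<delta> z h - \<delta> z k) =
        (E (w + s *\<^sub>C h) - E w - s *\<^sub>C \<delta> w h) + (E (z + s *\<^sub>C k) - E z - s *\<^sub>C \<delta> z k)
        - (E (z + s *\<^sub>C (h + k)) - E z - s *\<^sub>C \<delta> z (h + k)) + s *\<^sub>C (\<delta> w h - \<delta> z h)"
      by (simp add: w_def scaleC_diff_right scaleC_add_right algebra_simps)
    then have "norm (s *\<^sub>C (\<delta> z (h + k) - \<delta> z h - \<delta> z k)) \<le>
        3 * K * (cmod s)\<^sup>2 + norm (s *\<^sub>C (\<delta> w h - \<delta> z h))"
      using rem[OF w n1(1) s] rem[OF z n1(2) s] rem[OF z n1(3) s]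
        norm_4'[of "E (w + s *\<^sub>C h) - E w - s *\<^sub>C \<delta> w h" "E (z + s *\<^sub>C k) - E z - s *\<^sub>C \<delta> z k"
          "E (z + s *\<^sub>C (h + k)) - E z - s *\<^sub>C \<delta> z (h + k)" "s *\<^sub>C (\<delta> w h - \<delta> z h)"]
      by simp
    then have "t\<^sup>2 * norm (\<delta> z (h + k) - \<delta> z h - \<delta> z k)
        \<le> t\<^sup>2 * (3 * K * t\<^sup>2 + norm (\<delta> w h - \<delta> z h))"
      using cs by (simp add: norm_scaleC power2_eq_square algebra_simps)
    then have "norm (\<delta> z (h + k) - \<delta> z h - \<delta> z k) \<le> 3 * K * t\<^sup>2 + norm (\<delta> w h - \<delta> z h)"
      using t by (simp only: mult_le_cancel_left_pos zero_less_power)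
    moreover have "norm (\<delta> w h - \<delta> z h) \<le> (2 * K + 2 * L) * t"
    proof -
      have "t * norm (\<delta> w h - \<delta> z h) \<le> t * ((2 * K + 2 * L) * t)"
        using cont by (simp add: power2_eq_square algebra_simps)
      then show ?thesis using t by (simp only: mult_le_cancel_left_pos)
    qed
    moreover have "3 * K * t\<^sup>2 \<le> 3 * K * t"
    proof -
      have "0 \<le> K * (cmod (complex_of_real \<rho>))\<^sup>2"
        using order_trans[OF norm_ge_zero rem[OF z, of 0 "complex_of_real \<rho>"]] \<rho> by simp
      then have "K \<ge> 0" using \<rho> by (simp add: zero_le_mult_iff)
      then show ?thesis using tt by (simp add: mult_left_mono)
    qed
    ultimately show "norm (\<delta> z (h + k) - \<delta> z h - \<delta> z k) \<le> (5 * K + 2 * L) * t"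
      by (simp add: algebra_simps)
  qed (use \<rho> in simp)
  then show ?thesis by (simp add: algebra_simps)
qed

text \<open>A locally bounded map that is holomorphic on complex lines, tested by norming functionals, is
  Frechet differentiable. Local boundedness makes the remainder along a line uniform over all
  directions of norm at most 1; it remains to see that the directional derivatives are linear in
  the direction, and homogeneity allows the proof of additivity to stay with short directions.\<close>

theorem Gateaux_holomorphic_imp_cholomorphic:
  fixes E :: "'a::complex_banach \<Rightarrow> 'b::complex_banach"
  assumes S: "open S" and \<Lambda>: "norming \<Lambda>"
    and hol: "\<And>l w h. l \<in> \<Lambda> \<Longrightarrow> (\<lambda>s. l (E (w + s *\<^sub>C h))) holomorphic_on {s. w + s *\<^sub>C h \<in> S}"
    and bdd: "\<And>z. z \<in> S \<Longrightarrow> \<exists>\<rho>>0. \<exists>M. \<forall>x\<in>ball z \<rho>. norm (E x) \<le> M"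
  shows "cholomorphic_on S E"
  unfolding cholomorphic_on_def
proof
  fix z assume z: "z \<in> S"
  obtain \<rho>1 where \<rho>1: "\<rho>1 > 0" "ball z \<rho>1 \<subseteq> S" using S z openE by blast
  obtain \<rho>2 M where \<rho>2: "\<rho>2 > 0" and M: "\<And>x. x \<in> ball z \<rho>2 \<Longrightarrow> norm (E x) \<le> M"
    using bdd[OF z] by blast
  define r where "r = min 2 (min \<rho>1 \<rho>2) / 2"
  define \<rho> where "\<rho> = r / 2"
  have r: "r > 0" "2 * r \<le> \<rho>1" "2 * r \<le> \<rho>2" "r \<le> 1" using \<rho>1 \<rho>2 by (auto simp: r_def)
  then have \<rho>: "0 < \<rho>" "\<rho> \<le> 1" "\<rho> < r" by (auto simp: \<rho>_def)
  define K where "K = 32 * M / r\<^sup>2"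
  have near: "w + s *\<^sub>C h \<in> ball z \<rho>1 \<inter> ball z \<rho>2"
    if "w \<in> ball z \<rho>" "norm h \<le> 1" "s \<in> ball 0 r" for w h s
  proof -
    have "norm (s *\<^sub>C h) \<le> cmod s * 1" using that by (simp add: norm_scaleC mult_left_mono del: mult_1_right)
    then have "norm (s *\<^sub>C h) < r" using that by simp
    moreover have "norm (z - w) < r" using that \<rho> by (simp add: dist_norm)
    ultimately have "norm (z - (w + s *\<^sub>C h)) < 2 * r" by norm
    then show ?thesis using r by (simp add: dist_norm)
  qed
  have "\<exists>d. \<forall>s. cmod s \<le> \<rho> \<longrightarrow> norm (E (w + s *\<^sub>C h) - E w - s *\<^sub>C d) \<le> K * (cmod s)\<^sup>2"
    if w: "w \<in> ball z \<rho>" and h: "norm h \<le> 1" for w h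
  proof -
    obtain d where "\<And>s. cmod s \<le> r / 2 \<Longrightarrow>
        norm (E (w + s *\<^sub>C h) - E (w + 0 *\<^sub>C h) - s *\<^sub>C d) \<le> 32 * M / r\<^sup>2 * (cmod s)\<^sup>2"
    proof (rule weak_Cauchy_remainder[OF \<Lambda> r(1)])
      show "(\<lambda>s. l (E (w + s *\<^sub>C h))) holomorphic_on ball 0 r" if "l \<in> \<Lambda>" for l
        using near[OF w h] \<rho>1 by (intro holomorphic_on_subset[OF hol[OF that]]) blast
      show "norm (E (w + s *\<^sub>C h)) \<le> M" if "s \<in> ball 0 r" for s
        using near[OF w h that] M by blast
    qed blast
    then show ?thesis unfolding K_def \<rho>_def by auto
  qed
  then obtain \<delta> where \<delta>: "\<And>w h s. w \<in> ball z \<rho> \<Longrightarrow> norm h \<le> 1 \<Longrightarrow> cmod s \<le> \<rho> \<Longrightarrow>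
      norm (E (w + s *\<^sub>C h) - E w - s *\<^sub>C \<delta> w h) \<le> K * (cmod s)\<^sup>2"
    by metis
  have zz: "z \<in> ball z \<rho>" using \<rho> by simp
  have K: "K \<ge> 0"
    using order_trans[OF norm_ge_zero M[of z]] \<rho>2 by (simp add: K_def)
  define B where "B = K * \<rho> + 2 * M / \<rho>"
  have norm_3: "norm c \<le> norm (a - b - c) + norm a + norm b" for a b c :: 'b
    by norm
  have \<delta>_bound: "norm (\<delta> w h) \<le> B" if w: "w \<in> ball z \<rho>" and h: "norm h \<le> 1" for w h
  proof -
    let ?s = "complex_of_real \<rho>"
    have le: "norm (E (w + ?s *\<^sub>C h) - E w - ?s *\<^sub>C \<delta> w h) \<le> K * \<rho>\<^sup>2"
      using \<delta>[OF w h, of ?s] \<rho> by simp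
    have "norm (E (w + ?s *\<^sub>C h)) \<le> M" using near[OF w h, of ?s] M \<rho> by auto
    moreover have "norm (E w) \<le> M" using near[OF w h, of 0] M r by auto
    ultimately have "norm (?s *\<^sub>C \<delta> w h) \<le> K * \<rho>\<^sup>2 + 2 * M"
      using le norm_3[of "?s *\<^sub>C \<delta> w h" "E (w + ?s *\<^sub>C h)" "E w"] by linarith
    then have "\<rho> * norm (\<delta> w h) \<le> K * \<rho>\<^sup>2 + 2 * M" using \<rho> by (simp add: norm_scaleC)
    then show ?thesis using \<rho> by (simp add: B_def power2_eq_square field_simps)
  qed
  have lip: "norm (E (w + s *\<^sub>C h) - E w) \<le> (K + B) * cmod s"
    if "w \<in> ball z \<rho>" "norm h \<le> 1" "cmod s \<le> \<rho>" for w h s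
  proof -
    have "norm (E (w + s *\<^sub>C h) - E w) \<le> K * (cmod s)\<^sup>2 + cmod s * norm (\<delta> w h)"
      using \<delta>[OF that] norm_triangle_sub[of "E (w + s *\<^sub>C h) - E w" "s *\<^sub>C \<delta> w h"]
      by (simp add: norm_scaleC)
    also have "\<dots> \<le> K * cmod s + cmod s * B"
    proof (intro add_mono mult_left_mono \<delta>_bound K)
      show "(cmod s)\<^sup>2 \<le> cmod s" using that \<rho> by (simp add: power2_eq_square mult_left_le)
    qed (use that in auto)
    finally show ?thesis by (simp add: algebra_simps)
  qed
  have add: "\<delta> z (h + k) = \<delta> z h + \<delta> z k" if "norm h \<le> 1 / 2" "norm k \<le> 1 / 2" for h k
    using line_derivative_add[OF \<rho>(1,2) \<delta> lip that] by blast
  have line: "line_derivative E z h (\<delta> z h)" if "norm h \<le> 1" for h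
    using line_derivativeI[OF \<rho>(1) \<delta>[OF zz that]] by blast
  \<comment> \<open>The bounds hold for directions of norm at most 1 only; \<open>D\<close> extends \<open>\<delta> z\<close> by homogeneity.\<close>
  define D where "D h = complex_of_real (norm h + 1) *\<^sub>C \<delta> z (complex_of_real (inverse (norm h + 1)) *\<^sub>C h)" for h
  have pos: "norm h + 1 > 0" for h :: 'a by (simp add: add_nonneg_pos)
  have D: "line_derivative E z h (D h)" for h
  proof -
    have "norm (complex_of_real (inverse (norm h + 1)) *\<^sub>C h) \<le> 1"
      unfolding norm_scaleC norm_of_real using pos[of h] by (simp add: divide_simps)
    from line_derivative_scale[OF line[OF this], of "complex_of_real (norm h + 1)"] show ?thesis
      using pos[of h] by (simp add: D_def scaleC_scaleC scaleC_one flip: of_real_mult of_real_add)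
  qed
  have D_small: "D h = \<delta> z h" if "norm h \<le> 1" for h
    using line_derivative_unique[OF D line[OF that]] .
  have D_scale: "D (c *\<^sub>C h) = c *\<^sub>C D h" for c h
    using line_derivative_unique[OF D line_derivative_scale[OF D]] .
  have D_add: "D (h + k) = D h + D k" for h k
  proof -
    define N where "N = 2 * (norm h + norm k + 1)"
    have N: "N > 0" "2 * norm h \<le> N" "2 * norm k \<le> N"
      by (auto simp: N_def add_nonneg_pos)
    let ?i = "complex_of_real (inverse N)"
    have small: "norm (?i *\<^sub>C h) \<le> 1 / 2" "norm (?i *\<^sub>C k) \<le> 1 / 2"
      unfolding norm_scaleC norm_of_real using N by (simp_all add: divide_simps)
    then have "norm (?i *\<^sub>C h + ?i *\<^sub>C k) \<le> 1"
      using norm_triangle_ineq[of "?i *\<^sub>C h" "?i *\<^sub>C k"] by linarith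
    then have "D (?i *\<^sub>C h + ?i *\<^sub>C k) = D (?i *\<^sub>C h) + D (?i *\<^sub>C k)"
      using small add[OF small] by (simp add: D_small)
    then have "?i *\<^sub>C D (h + k) = ?i *\<^sub>C (D h + D k)"
      by (simp only: D_scale scaleC_add_right[symmetric])
    then have "complex_of_real N *\<^sub>C ?i *\<^sub>C D (h + k) = complex_of_real N *\<^sub>C ?i *\<^sub>C (D h + D k)"
      by simp
    then show ?thesis using N by (simp add: scaleC_scaleC scaleC_one flip: of_real_mult)
  qed
  have D_unit: "D h = complex_of_real (norm h) *\<^sub>C \<delta> z (complex_of_real (inverse (norm h)) *\<^sub>C h)"
    if "h \<noteq> 0" for h
  proof -
    have "D (complex_of_real (inverse (norm h)) *\<^sub>C h) = \<delta> z (complex_of_real (inverse (norm h)) *\<^sub>C h)"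
      using that by (intro D_small) (simp add: norm_scaleC norm_inverse)
    then show ?thesis using that D_scale
      by (metis D_scale mult.commute of_real_1 of_real_mult right_inverse norm_eq_zero scaleC_one scaleC_scaleC)
  qed
  have "bounded_linear D"
  proof (rule bounded_linear_intro[where K=B])
    show "D (r *\<^sub>R x) = r *\<^sub>R D x" for r x by (simp add: scaleR_scaleC D_scale)
    fix h show "norm (D h) \<le> norm h * B"
    proof (cases "h = 0")
      case True
      then show ?thesis using D_add[of 0 0] by simp
    next
      case False
      have "norm (\<delta> z (complex_of_real (inverse (norm h)) *\<^sub>C h)) \<le> B"
        using False by (intro \<delta>_bound zz) (simp add: norm_scaleC norm_inverse)
      then show ?thesis using False by (simp add: D_unit norm_scaleC)
    qed
  qed (rule D_add)
  then have "bounded_clinear D" by (simp add: bounded_clinear_def D_scale)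
  moreover have "(E has_derivative D) (at z)"
    unfolding has_derivative_at_alt
  proof (intro conjI allI impI)
    fix e :: real assume e: "e > 0"
    show "\<exists>d>0. \<forall>y. norm (y - z) < d \<longrightarrow> norm (E y - E z - D (y - z)) \<le> e * norm (y - z)"
    proof (intro exI[of _ "min \<rho> (e / (K + 1))"] conjI allI impI)
      show "min \<rho> (e / (K + 1)) > 0" using e K \<rho> by simp
      fix y assume y: "norm (y - z) < min \<rho> (e / (K + 1))"
      show "norm (E y - E z - D (y - z)) \<le> e * norm (y - z)"
      proof (cases "y = z")
        case True
        then show ?thesis using \<open>bounded_linear D\<close> by (simp add: linear_0 bounded_linear.linear)
      next
        case False
        let ?n = "complex_of_real (norm (y - z))"
        let ?u = "complex_of_real (inverse (norm (y - z))) *\<^sub>C (y - z)"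
        have "?n *\<^sub>C ?u = y - z"
          using False by (simp add: scaleC_scaleC scaleC_one flip: of_real_mult)
        moreover have "D (y - z) = ?n *\<^sub>C \<delta> z ?u" using False by (intro D_unit) simp
        ultimately have "norm (E y - E z - D (y - z)) \<le> K * (norm (y - z))\<^sup>2"
          using \<delta>[OF zz, of ?u ?n] y False by (simp add: norm_scaleC norm_inverse)
        also have "\<dots> \<le> e * norm (y - z)"
        proof -
          have "K * norm (y - z) \<le> (K + 1) * norm (y - z)" by (simp add: algebra_simps)
          also have "\<dots> \<le> e" using y K by (simp add: pos_less_divide_eq mult.commute)
          finally show ?thesis by (simp add: power2_eq_square mult_right_mono flip: mult.assoc)
        qed
        finally show ?thesis .
      qed
    qed
  qed (rule \<open>bounded_linear D\<close>)
  ultimately show "\<exists>D. bounded_clinear D \<and> (E has_derivative D) (at z)" by blast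
qed

lemma cholomorphic_on_fderiv:
  assumes "cholomorphic_on S F" "z \<in> S"
  shows "(F has_derivative blinfun_apply (fderiv F z)) (at z)"
    and "blinfun_apply (fderiv F z) (c *\<^sub>C v) = c *\<^sub>C blinfun_apply (fderiv F z) v"
proof -
  obtain D where D: "bounded_clinear D" "(F has_derivative D) (at z)"
    using assms by (auto simp: cholomorphic_on_def)
  have "blinfun_apply (fderiv F z) = D"
    using D frechet_derivative_at[OF D(2)] bounded_linear_Blinfun_apply[of D]
    by (simp add: fderiv_def bounded_clinear_def)
  with D show "(F has_derivative blinfun_apply (fderiv F z)) (at z)"
    and "blinfun_apply (fderiv F z) (c *\<^sub>C v) = c *\<^sub>C blinfun_apply (fderiv F z) v"
    by (simp_all add: bounded_clinear_def)
qed

lemma fderiv_eqI: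
  assumes "(F has_derivative D) (at z)"
  shows "blinfun_apply (fderiv F z) = D"
  using frechet_derivative_at[OF assms] bounded_linear_Blinfun_apply[of D]
    has_derivative_bounded_linear[OF assms]
  by (simp add: fderiv_def)

lemma fderiv_along_line:
  assumes hol: "cholomorphic_on S F" and l: "bounded_clinear l" and s: "w + s *\<^sub>C h \<in> S"
  shows "((\<lambda>s. l (F (w + s *\<^sub>C h))) has_field_derivative
    l (blinfun_apply (fderiv F (w + s *\<^sub>C h)) h)) (at s)"
proof -
  have inner: "((\<lambda>s. w + s *\<^sub>C h) has_derivative (\<lambda>t. t *\<^sub>C h)) (at s)"
    using bounded_linear.has_derivative[OF bounded_linear_scaleC_left[of h] has_derivative_ident]
    by (auto intro!: derivative_eq_intros)
  have "((\<lambda>s. F (w + s *\<^sub>C h)) has_derivative (\<lambda>t. blinfun_apply (fderiv F (w + s *\<^sub>C h)) (t *\<^sub>C h))) (at s)"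
    using has_derivative_compose[OF inner cholomorphic_on_fderiv(1)[OF hol s]] .
  from bounded_linear.has_derivative[OF bounded_clinear_bounded_linear[OF l] this]
  show ?thesis
    unfolding has_field_derivative_def cholomorphic_on_fderiv(2)[OF hol s] bounded_clinear_cmult[OF l]
    by (simp add: mult.commute[of _ "l _"])
qed

lemma line_in_open:
  fixes w :: "'a::complex_banach"
  assumes "open S"
  shows "open {s::complex. w + s *\<^sub>C h \<in> S}"
proof -
  have "continuous_on UNIV (\<lambda>s::complex. w + s *\<^sub>C h)"
    by (intro continuous_on_add continuous_on_const linear_continuous_on bounded_linear_scaleC_left)
  from open_vimage[OF assms this] show ?thesis by (simp add: vimage_def)
qed

text \<open>Continuity bounds \<open>F\<close> near \<open>z\<close>, and Cauchy's inequalities along lines through nearby points turn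
  that bound into one for the derivative and the first order remainder, uniformly over base points,
  directions and functionals.\<close>

lemma fderiv_local_estimate:
  fixes F :: "'a::complex_banach \<Rightarrow> 'b::complex_banach"
  assumes S: "open S" and hol: "cholomorphic_on S F" and z: "z \<in> S"
  obtains \<rho> M K where "\<rho> > 0" "ball z (2 * \<rho>) \<subseteq> S"
    and "\<And>w. w \<in> ball z \<rho> \<Longrightarrow> norm (fderiv F w) \<le> M"
    and "\<And>w v l s. w \<in> ball z \<rho> \<Longrightarrow> norm v \<le> 1 \<Longrightarrow> bounded_clinear l \<Longrightarrow> (\<And>y. cmod (l y) \<le> norm y) \<Longrightarrow>
      cmod s \<le> \<rho> / 2 \<Longrightarrow>
      cmod (l (F (w + s *\<^sub>C v)) - l (F w) - s * l (blinfun_apply (fderiv F w) v)) \<le> K * (cmod s)\<^sup>2"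
proof -
  obtain \<rho>1 where \<rho>1: "\<rho>1 > 0" "ball z \<rho>1 \<subseteq> S" using S z openE by blast
  have "isCont F z"
    using cholomorphic_on_fderiv(1)[OF hol z] has_derivative_continuous by blast
  then obtain \<rho>2 where \<rho>2: "\<rho>2 > 0" and near: "\<And>x. dist x z < \<rho>2 \<Longrightarrow> dist (F x) (F z) < 1"
    unfolding continuous_at_eps_delta using zero_less_one by blast
  define B where "B = norm (F z) + 1"
  have B: "norm (F x) \<le> B" if "x \<in> ball z \<rho>2" for x
    using near[of x] that norm_triangle_sub[of "F x" "F z"]
    by (simp add: B_def dist_norm norm_minus_commute)
  define \<rho> where "\<rho> = min \<rho>1 \<rho>2 / 2"
  have \<rho>: "\<rho> > 0" "2 * \<rho> \<le> \<rho>1" "2 * \<rho> \<le> \<rho>2" using \<rho>1 \<rho>2 by (auto simp: \<rho>_def)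
  have shift: "w + s *\<^sub>C v \<in> ball z (2 * \<rho>)"
    if "w \<in> ball z \<rho>" "norm v \<le> 1" "s \<in> ball 0 \<rho>" for w s v
  proof -
    have "norm (s *\<^sub>C v) \<le> cmod s"
      using that by (simp add: norm_scaleC mult_left_le)
    then show ?thesis
      using that norm_triangle_ineq4[of "z - w" "s *\<^sub>C v"] by (simp add: dist_norm algebra_simps)
  qed
  have g: "(\<lambda>s. l (F (w + s *\<^sub>C v))) holomorphic_on ball 0 \<rho>"
      "\<And>s. s \<in> ball 0 \<rho> \<Longrightarrow> cmod (l (F (w + s *\<^sub>C v))) \<le> B"
      "deriv (\<lambda>s. l (F (w + s *\<^sub>C v))) 0 = l (blinfun_apply (fderiv F w) v)"
    if w: "w \<in> ball z \<rho>" and v: "norm v \<le> 1" and l: "bounded_clinear l" "\<And>y. cmod (l y) \<le> norm y"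
    for w v l
  proof -
    have S': "w + s *\<^sub>C v \<in> S" if "s \<in> ball 0 \<rho>" for s
      using shift[OF w v that] \<rho>1 \<rho> by auto
    show "(\<lambda>s. l (F (w + s *\<^sub>C v))) holomorphic_on ball 0 \<rho>"
      using fderiv_along_line[OF hol l(1) S']
      by (subst holomorphic_on_open) blast+
    show "cmod (l (F (w + s *\<^sub>C v))) \<le> B" if "s \<in> ball 0 \<rho>" for s
    proof -
      have "w + s *\<^sub>C v \<in> ball z \<rho>2" using shift[OF w v that] \<rho> by auto
      then show ?thesis using order_trans[OF l(2) B] by blast
    qed
    show "deriv (\<lambda>s. l (F (w + s *\<^sub>C v))) 0 = l (blinfun_apply (fderiv F w) v)"
      using DERIV_imp_deriv[OF fderiv_along_line[OF hol l(1) S', of 0]] \<rho> by simp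
  qed
  show thesis
  proof (rule that)
    show "\<rho> > 0" by fact
    show "ball z (2 * \<rho>) \<subseteq> S" using \<rho>1 \<rho> by auto
    show "norm (fderiv F w) \<le> 2 * B / \<rho>" if w: "w \<in> ball z \<rho>" for w
    proof -
      have "cmod (m (fderiv F w)) \<le> 2 * B / \<rho>"
        if m: "m \<in> {\<lambda>A. l (blinfun_apply A v) | l v.
          l \<in> {l. bounded_clinear l \<and> (\<forall>x. cmod (l x) \<le> norm x)} \<and> norm v \<le> 1}" for m
      proof -
        obtain l v where m: "m = (\<lambda>A. l (blinfun_apply A v))" and l: "bounded_clinear l" "\<And>y. cmod (l y) \<le> norm y"
          and v: "norm v \<le> 1"
          using m by blast
        show ?thesis
          using Cauchy_remainder(1)[OF g(1)[OF w v l] \<rho>(1) g(2)[OF w v l]] g(3)[OF w v l] by (simp add: m)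
      qed
      then show ?thesis
        using norming_blinfun[OF norming_dual] unfolding norming_def by blast
    qed
    show "cmod (l (F (w + s *\<^sub>C v)) - l (F w) - s * l (blinfun_apply (fderiv F w) v)) \<le> 32 * B / \<rho>\<^sup>2 * (cmod s)\<^sup>2"
      if w: "w \<in> ball z \<rho>" and v: "norm v \<le> 1" and l: "bounded_clinear l" "\<And>y. cmod (l y) \<le> norm y"
        and s: "cmod s \<le> \<rho> / 2" for w v l s
      using Cauchy_remainder(2)[OF g(1)[OF w v l] \<rho>(1) g(2)[OF w v l] s] g(3)[OF w v l] by simp
  qed
qed

text \<open>By the uniform remainder bound, the derivative in the direction \<open>v\<close> is a locally uniform limit of
  difference quotients. Those are holomorphic in \<open>s\<close>, hence so is the limit.\<close>

lemma fderiv_holomorphic_along_line: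
  fixes F :: "'a::complex_banach \<Rightarrow> 'b::complex_banach"
  assumes S: "open S" and hol: "cholomorphic_on S F"
    and l: "bounded_clinear l" "\<And>y. cmod (l y) \<le> norm y" and v: "norm v \<le> 1"
  shows "(\<lambda>s. l (blinfun_apply (fderiv F (w + s *\<^sub>C h)) v)) holomorphic_on {s. w + s *\<^sub>C h \<in> S}"
proof -
  let ?U = "{s. w + s *\<^sub>C h \<in> S}"
  have "(\<lambda>s. l (blinfun_apply (fderiv F (w + s *\<^sub>C h)) v)) analytic_on ?U"
    unfolding analytic_on_def
  proof
    fix s0 assume "s0 \<in> ?U"
    then have z: "w + s0 *\<^sub>C h \<in> S" by simp
    obtain \<rho> M K where \<rho>: "\<rho> > 0" and sub: "ball (w + s0 *\<^sub>C h) (2 * \<rho>) \<subseteq> S"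
      and rem: "\<And>y v l s. y \<in> ball (w + s0 *\<^sub>C h) \<rho> \<Longrightarrow> norm v \<le> 1 \<Longrightarrow> bounded_clinear l \<Longrightarrow>
        (\<And>y. cmod (l y) \<le> norm y) \<Longrightarrow> cmod s \<le> \<rho> / 2 \<Longrightarrow>
        cmod (l (F (y + s *\<^sub>C v)) - l (F y) - s * l (blinfun_apply (fderiv F y) v)) \<le> K * (cmod s)\<^sup>2"
      using fderiv_local_estimate[OF S hol z] by metis
    obtain d where d: "d > 0" and near: "ball s0 d \<subseteq> {s. w + s *\<^sub>C h \<in> ball (w + s0 *\<^sub>C h) \<rho>}"
      using openE[OF line_in_open[OF open_ball, of w h "w + s0 *\<^sub>C h" \<rho>], of s0] \<rho> by auto
    define t where "t n = complex_of_real (\<rho> / 2 * inverse (real (Suc n)))" for n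
    have t0: "t n \<noteq> 0" and t: "cmod (t n) \<le> \<rho> / 2" for n
    proof -
      have "cmod (t n) = \<rho> / 2 * inverse (real (Suc n))"
        unfolding t_def norm_of_real using \<rho> by simp
      moreover have "inverse (real (Suc n)) \<le> 1" by (simp add: divide_simps)
      ultimately show "cmod (t n) \<le> \<rho> / 2" using \<rho> by (simp add: mult_left_le)
      show "t n \<noteq> 0" using \<rho> unfolding t_def of_real_eq_0_iff by simp
    qed
    have t_lim: "(\<lambda>n. cmod (t n)) \<longlonglongrightarrow> 0"
    proof -
      have "(\<lambda>n. \<rho> / 2 * inverse (real (Suc n))) \<longlonglongrightarrow> 0"
        using tendsto_mult_right_zero[OF LIMSEQ_inverse_real_of_nat] by simp
      then have "t \<longlonglongrightarrow> 0" unfolding t_def by (rule tendsto_of_real[where a=0, unfolded of_real_0])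
      then show ?thesis using tendsto_norm_zero by blast
    qed
    define f where "f n s = (l (F ((w + t n *\<^sub>C v) + s *\<^sub>C h)) - l (F (w + s *\<^sub>C h))) / t n" for n s
    have "(\<lambda>s. l (blinfun_apply (fderiv F (w + s *\<^sub>C h)) v)) holomorphic_on ball s0 d"
    proof (rule holomorphic_uniform_sequence[where f=f])
      fix n
      have "w + t n *\<^sub>C v + s *\<^sub>C h \<in> S \<and> w + s *\<^sub>C h \<in> S" if "s \<in> ball s0 d" for s
      proof -
        have "norm (t n *\<^sub>C v) \<le> cmod (t n)"
          using v by (simp add: norm_scaleC mult_left_le)
        then have "norm (t n *\<^sub>C v) < \<rho>" using t[of n] \<rho> by linarith
        moreover have "dist (w + s0 *\<^sub>C h) (w + s *\<^sub>C h) < \<rho>" using near that by auto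
        ultimately have "dist (w + s0 *\<^sub>C h) (w + t n *\<^sub>C v + s *\<^sub>C h) < 2 * \<rho>"
          using norm_triangle_ineq4[of "(w + s0 *\<^sub>C h) - (w + s *\<^sub>C h)" "t n *\<^sub>C v"]
          by (simp add: dist_norm algebra_simps)
        moreover have "dist (w + s0 *\<^sub>C h) (w + s *\<^sub>C h) < 2 * \<rho>"
          using \<open>dist (w + s0 *\<^sub>C h) (w + s *\<^sub>C h) < \<rho>\<close> \<rho> by linarith
        ultimately show ?thesis using sub by (auto simp del: dist_add_cancel)
      qed
      then have "\<And>s. s \<in> ball s0 d \<Longrightarrow> (\<lambda>s. l (F ((w + t n *\<^sub>C v) + s *\<^sub>C h))) field_differentiable at s"
        "\<And>s. s \<in> ball s0 d \<Longrightarrow> (\<lambda>s. l (F (w + s *\<^sub>C h))) field_differentiable at s"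
        using fderiv_along_line[OF hol l(1)] unfolding field_differentiable_def by blast+
      then show "f n holomorphic_on ball s0 d"
        unfolding f_def[abs_def] holomorphic_on_def using t0
        by (intro ballI field_differentiable_divide field_differentiable_diff field_differentiable_const)
          (auto intro: field_differentiable_at_within)
    next
      fix s1 assume "s1 \<in> ball s0 d"
      then obtain e where e: "e > 0" "cball s1 e \<subseteq> ball s0 d"
        using open_contains_cball open_ball by blast
      have "uniform_limit (cball s1 e) f (\<lambda>s. l (blinfun_apply (fderiv F (w + s *\<^sub>C h)) v)) sequentially"
      proof (rule uniform_limitI)
        fix \<epsilon> :: real assume \<epsilon>: "\<epsilon> > 0"
        have "(\<lambda>n. K * cmod (t n)) \<longlonglongrightarrow> 0" using tendsto_mult_right_zero[OF t_lim] .
        then have "\<forall>\<^sub>F n in sequentially. K * cmod (t n) < \<epsilon>"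
          using \<epsilon> by (intro order_tendstoD(2)) auto
        then show "\<forall>\<^sub>F n in sequentially. \<forall>s\<in>cball s1 e.
            dist (f n s) (l (blinfun_apply (fderiv F (w + s *\<^sub>C h)) v)) < \<epsilon>"
        proof (eventually_elim, intro ballI)
          fix n s assume n: "K * cmod (t n) < \<epsilon>" and "s \<in> cball s1 e"
          with e have s: "w + s *\<^sub>C h \<in> ball (w + s0 *\<^sub>C h) \<rho>" using near by auto
          have "f n s - l (blinfun_apply (fderiv F (w + s *\<^sub>C h)) v) =
              (l (F (w + s *\<^sub>C h + t n *\<^sub>C v)) - l (F (w + s *\<^sub>C h))
                - t n * l (blinfun_apply (fderiv F (w + s *\<^sub>C h)) v)) / t n"
            using t0[of n] by (simp add: f_def field_simps add.commute add.left_commute)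
          then have "cmod (f n s - l (blinfun_apply (fderiv F (w + s *\<^sub>C h)) v)) \<le> K * (cmod (t n))\<^sup>2 / cmod (t n)"
            using rem[OF s v l t, of n] by (simp add: norm_divide divide_right_mono)
          then show "dist (f n s) (l (blinfun_apply (fderiv F (w + s *\<^sub>C h)) v)) < \<epsilon>"
            using n t0[of n] by (simp add: dist_norm power2_eq_square)
        qed
      qed
      with e show "\<exists>e>0. cball s1 e \<subseteq> ball s0 d \<and>
          uniform_limit (cball s1 e) f (\<lambda>s. l (blinfun_apply (fderiv F (w + s *\<^sub>C h)) v)) sequentially"
        by blast
    qed simp
    with d show "\<exists>d>0. (\<lambda>s. l (blinfun_apply (fderiv F (w + s *\<^sub>C h)) v)) holomorphic_on ball s0 d" by blast
  qed
  then show ?thesis by (rule analytic_imp_holomorphic)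
qed

text \<open>Since the target is an arbitrary complex Banach space, the theorem can be applied repeatedly, and so
  all iterated Frechet derivatives exist.\<close>

theorem cholomorphic_fderiv:
  fixes F :: "'a::complex_banach \<Rightarrow> 'b::complex_banach"
  assumes S: "open S" and hol: "cholomorphic_on S F"
  shows "cholomorphic_on S (fderiv F)"
proof (rule Gateaux_holomorphic_imp_cholomorphic[OF S norming_blinfun[OF norming_dual]])
  fix m w h
  assume "m \<in> {\<lambda>A :: 'a \<Rightarrow>\<^sub>L 'b. l (blinfun_apply A v) | l v.
    l \<in> {l. bounded_clinear l \<and> (\<forall>x. cmod (l x) \<le> norm x)} \<and> norm v \<le> 1}"
  then obtain l v where m: "m = (\<lambda>A. l (blinfun_apply A v))" and l: "bounded_clinear l" "\<And>y. cmod (l y) \<le> norm y"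
    and v: "norm v \<le> 1"
    by blast
  show "(\<lambda>s. m (fderiv F (w + s *\<^sub>C h))) holomorphic_on {s. w + s *\<^sub>C h \<in> S}"
    unfolding m by (rule fderiv_holomorphic_along_line[OF S hol l v])
next
  fix z assume "z \<in> S"
  from fderiv_local_estimate[OF S hol this] show "\<exists>\<rho>>0. \<exists>M. \<forall>x\<in>ball z \<rho>. norm (fderiv F x) \<le> M"
    by metis
qed

text \<open>Composing with \<open>A \<mapsto> l (A u)\<close> reduces each further derivative to the derivative of a holomorphic
  map along the line spanned by \<open>u\<close>.\<close>

lemma higher_deriv_along_line:
  fixes F :: "'a::complex_banach \<Rightarrow> 'b::complex_banach" and l :: "'b \<Rightarrow> complex"
  assumes hol: "cholomorphic_on (ball 0 1) F" and l: "bounded_clinear l" and u: "norm u = 1"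
  defines "g \<equiv> \<lambda>s. l (F (s *\<^sub>C u))"
  shows "(deriv ^^ 2) g 0 = l (fderiv (fderiv F) 0 u u)"
    and "(deriv ^^ 3) g 0 = l (fderiv (fderiv (fderiv F)) 0 u u u)"
    and "(deriv ^^ 4) g 0 = l (fderiv (fderiv (fderiv (fderiv F))) 0 u u u u)"
proof -
  define disc where "disc = (ball 0 1 :: complex set)"
  note step = fderiv_along_line[where w=0, simplified]
  note hol1 = cholomorphic_fderiv[OF open_ball hol]
  note hol2 = cholomorphic_fderiv[OF open_ball hol1]
  note hol3 = cholomorphic_fderiv[OF open_ball hol2]
  note l1 = bounded_clinear_apply[OF l, of u]
  note l2 = bounded_clinear_apply[OF l1, of u]
  note l3 = bounded_clinear_apply[OF l2, of u]
  have mem: "s *\<^sub>C u \<in> ball 0 1" if "s \<in> disc" for s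
    using that u by (simp add: disc_def norm_scaleC)
  have cong: "deriv f s = deriv f' s" if "\<And>s. s \<in> disc \<Longrightarrow> f s = f' s" "s \<in> disc" for f f' s
    using that eventually_nhds_in_open[of disc s]
    by (intro deriv_cong_ev refl) (auto simp: disc_def elim!: eventually_mono)
  have d1: "deriv g s = l (fderiv F (s *\<^sub>C u) u)" if "s \<in> disc" for s
    unfolding g_def by (rule DERIV_imp_deriv[OF step[OF hol l mem[OF that]]])
  have d2: "(deriv ^^ 2) g s = l (fderiv (fderiv F) (s *\<^sub>C u) u u)" if "s \<in> disc" for s
    using cong[OF d1 that] DERIV_imp_deriv[OF step[OF hol1 l1 mem[OF that]]] by (simp add: numeral_2_eq_2)
  have d3: "(deriv ^^ 3) g s = l (fderiv (fderiv (fderiv F)) (s *\<^sub>C u) u u u)" if "s \<in> disc" for s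
    using cong[OF d2 that] DERIV_imp_deriv[OF step[OF hol2 l2 mem[OF that]]] by (simp add: numeral_eq_Suc)
  have d4: "(deriv ^^ 4) g s = l (fderiv (fderiv (fderiv (fderiv F))) (s *\<^sub>C u) u u u u)" if "s \<in> disc" for s
    using cong[OF d3 that] DERIV_imp_deriv[OF step[OF hol3 l3 mem[OF that]]] by (simp add: numeral_eq_Suc)
  have "0 \<in> disc" by (simp add: disc_def)
  from d2[OF this] d3[OF this] d4[OF this]
  show "(deriv ^^ 2) g 0 = l (fderiv (fderiv F) 0 u u)"
    and "(deriv ^^ 3) g 0 = l (fderiv (fderiv (fderiv F)) 0 u u u)"
    and "(deriv ^^ 4) g 0 = l (fderiv (fderiv (fderiv (fderiv F))) 0 u u u u)"
    by simp_all
qed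

section \<open>Coefficients of Schwarz functions\<close>

abbreviation taylor :: "(complex \<Rightarrow> complex) \<Rightarrow> nat \<Rightarrow> complex"
  where "taylor f n \<equiv> fps_nth (fps_expansion f 0) n"

lemma has_fps_expansion_disc:
  "f holomorphic_on ball 0 1 \<Longrightarrow> f has_fps_expansion fps_expansion f 0"
  by (rule has_fps_expansion_fps_expansion[of "ball 0 1"]) auto

lemma fps_eq_on_disc:
  fixes f g :: "complex \<Rightarrow> complex"
  assumes "f has_fps_expansion A" "g has_fps_expansion B" "\<And>z. z \<in> ball 0 1 \<Longrightarrow> f z = g z"
  shows "A = B"
proof -
  have "\<forall>\<^sub>F z in nhds 0. f z = g z"
    using eventually_nhds_in_open[of "ball 0 1" "0::complex"] assms(3)
    by (auto elim!: eventually_mono)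
  then have "f has_fps_expansion B"
    using assms(2) has_fps_expansion_cong by blast
  with assms(1) show ?thesis by (rule fps_expansion_unique_complex)
qed

lemma taylor_0: "taylor f 0 = f 0"
  by (simp add: fps_expansion_def)

text \<open>Unless \<open>f\<close> is a constant of modulus 1, the Moebius transformation that moves \<open>f 0\<close> to \<open>0\<close> maps \<open>f\<close> to
  a function to which the Schwarz lemma applies; \<open>g\<close> is its quotient by \<open>z\<close>. The relation is stated
  without a denominator, so that the constant case fits in with \<open>g = 0\<close>.\<close>

lemma Schur_step:
  assumes hol: "f holomorphic_on ball 0 1" and le: "\<And>z. z \<in> ball 0 1 \<Longrightarrow> cmod (f z) \<le> 1"
  obtains g where "g holomorphic_on ball 0 1" "\<And>z. z \<in> ball 0 1 \<Longrightarrow> cmod (g z) \<le> 1"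
    "\<forall>z\<in>ball 0 1. f z * (1 + cnj (f 0) * (z * g z)) = f 0 + z * g z"
proof (cases "\<exists>w\<in>ball 0 1. cmod (f w) = 1")
  case True
  then obtain w where w: "w \<in> ball 0 1" "cmod (f w) = 1" by blast
  have "f constant_on ball 0 1"
  proof (rule maximum_modulus_principle[OF hol, where U="ball 0 1" and \<xi>=w])
    show "cmod (f z) \<le> cmod (f w)" if "z \<in> ball 0 1" for z
      using le[OF that] w(2) by simp
  qed (use w(1) in simp_all)
  then obtain c where c: "\<And>z. z \<in> ball 0 1 \<Longrightarrow> f z = c"
    unfolding constant_on_def by blast
  show thesis
    by (rule that[of "\<lambda>_. 0"]) (simp_all add: c)
next
  case False
  with le have lt: "cmod (f z) < 1" if "z \<in> ball 0 1" for z
    using that by (metis order_le_less)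
  define a where "a = f 0"
  define m where "m z = (f z - a) / (1 - cnj a * f z)" for z
  have a: "cmod a < 1" using lt[of 0] by (simp add: a_def)
  have denom: "1 - cnj a * f z \<noteq> 0" if "z \<in> ball 0 1" for z
  proof
    assume "1 - cnj a * f z = 0"
    then have "cmod (cnj a * f z) = 1" by simp
    moreover have "cmod (cnj a * f z) < 1"
      using a lt[OF that] mult_strict_mono'[of "cmod a" 1 "cmod (f z)" 1] by (simp add: norm_mult)
    ultimately show False by simp
  qed
  have "m holomorphic_on ball 0 1"
    unfolding m_def[abs_def] using denom by (intro holomorphic_intros hol) auto
  moreover have "m 0 = 0" by (simp add: m_def a_def)
  moreover have m: "cmod (m z) < 1" if "z \<in> ball 0 1" for z
  proof -
    have "(cmod (1 - cnj a * f z))\<^sup>2 - (cmod (f z - a))\<^sup>2 = (1 - (cmod a)\<^sup>2) * (1 - (cmod (f z))\<^sup>2)"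
      unfolding cmod_power2 by (simp add: algebra_simps power2_eq_square)
    also have "\<dots> > 0"
      using power_strict_mono[OF a norm_ge_zero, of 2] power_strict_mono[OF lt[OF that] norm_ge_zero, of 2]
      by (intro mult_pos_pos) (simp_all only: power_one diff_gt_0_iff_gt zero_less_numeral)
    finally have "(cmod (f z - a))\<^sup>2 < (cmod (1 - cnj a * f z))\<^sup>2"
      by (simp only: diff_gt_0_iff_gt)
    then have "cmod (f z - a) < cmod (1 - cnj a * f z)"
      by (rule power2_less_imp_less) simp
    then show ?thesis
      using denom[OF that] by (simp add: m_def norm_divide)
  qed
  ultimately obtain g where g: "g holomorphic_on ball 0 1" "\<And>z. cmod z < 1 \<Longrightarrow> m z = z * g z" "deriv m 0 = g 0"
    using Schwarz3[of m 1] by metis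
  have "cmod (g z) \<le> 1" if "z \<in> ball 0 1" for z
  proof (cases "z = 0")
    case True
    then show ?thesis
      using Schwarz_Lemma(2)[OF \<open>m holomorphic_on ball 0 1\<close> \<open>m 0 = 0\<close>, of 0] m g(3) by simp
  next
    case False
    have "cmod z * cmod (g z) \<le> cmod z * 1"
      using Schwarz_Lemma(1)[OF \<open>m holomorphic_on ball 0 1\<close> \<open>m 0 = 0\<close>, of z] m g(2)[of z] that
      by (simp add: norm_mult)
    then show ?thesis
      using False mult_left_le_imp_le[of "cmod z" "cmod (g z)" 1] by simp
  qed
  moreover have "f z * (1 + cnj (f 0) * (z * g z)) = f 0 + z * g z" if "z \<in> ball 0 1" for z
    using denom[OF that] g(2)[of z, symmetric] that
    by (simp add: m_def a_def[symmetric] field_simps)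
  ultimately show thesis using that g(1) by blast
qed

lemma Schur_step_coefficients:
  assumes hol: "f holomorphic_on ball 0 1" "g holomorphic_on ball 0 1"
    and eq: "\<forall>z\<in>ball 0 1. f z * (1 + cnj a * (z * g z)) = a + z * g z"
    and a: "f 0 = a"
  shows "taylor f 1 = (1 - (cmod a)\<^sup>2) * taylor g 0"
    and "taylor f 2 = (1 - (cmod a)\<^sup>2) * (taylor g 1 - cnj a * (taylor g 0)\<^sup>2)"
proof -
  define A where "A = fps_expansion f 0"
  define B where "B = fps_expansion g 0"
  note exp = hol[THEN has_fps_expansion_disc, folded A_def B_def]
  have "A * (1 + fps_const (cnj a) * (fps_X * B)) = fps_const a + fps_X * B"
    by (rule fps_eq_on_disc[OF _ _ bspec[OF eq]]) (auto intro!: fps_expansion_intros exp)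
  then have "fps_nth (A * (1 + fps_const (cnj a) * (fps_X * B))) n = fps_nth (fps_const a + fps_X * B) n" for n
    by simp
  from this[of 1] this[of 2]
  have c1: "fps_nth A 1 = fps_nth B 0 - cnj a * (a * fps_nth B 0)"
    and c2: "fps_nth A 2 = fps_nth B 1 - cnj a * (a * fps_nth B 1 + fps_nth A 1 * fps_nth B 0)"
    using a taylor_0[of f]
    by (auto simp: A_def[symmetric] fps_mult_nth numeral_2_eq_2 algebra_simps)
  have aa: "complex_of_real (1 - (cmod a)\<^sup>2) = 1 - cnj a * a"
    by (simp only: of_real_diff of_real_1 complex_norm_square mult.commute)
  show "taylor f 1 = (1 - (cmod a)\<^sup>2) * taylor g 0"
    unfolding aa using c1 by (simp add: A_def B_def algebra_simps)
  show "taylor f 2 = (1 - (cmod a)\<^sup>2) * (taylor g 1 - cnj a * (taylor g 0)\<^sup>2)"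
    unfolding aa using c2 unfolding c1 by (simp add: A_def B_def algebra_simps power2_eq_square)
qed

lemma Schwarz_coefficients:
  assumes hol: "\<omega> holomorphic_on ball 0 1" and zero: "\<omega> 0 = 0"
    and le: "\<And>z. z \<in> ball 0 1 \<Longrightarrow> cmod (\<omega> z) \<le> 1"
  obtains x y :: complex where "cmod (taylor \<omega> 1) \<le> 1" "cmod x \<le> 1" "cmod y \<le> 1"
    "taylor \<omega> 2 = (1 - (cmod (taylor \<omega> 1))\<^sup>2) * x"
    "taylor \<omega> 3 = (1 - (cmod (taylor \<omega> 1))\<^sup>2) * ((1 - (cmod x)\<^sup>2) * y - cnj (taylor \<omega> 1) * x\<^sup>2)"
proof -
  obtain f where f: "f holomorphic_on ball 0 1" "\<And>z. z \<in> ball 0 1 \<Longrightarrow> cmod (f z) \<le> 1"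
    "\<And>z. z \<in> ball 0 1 \<Longrightarrow> \<omega> z = z * f z"
    by (rule Schur_step[OF hol le]) (use zero in auto)
  obtain g where g: "g holomorphic_on ball 0 1" "\<And>z. z \<in> ball 0 1 \<Longrightarrow> cmod (g z) \<le> 1"
    "\<forall>z\<in>ball 0 1. f z * (1 + cnj (f 0) * (z * g z)) = f 0 + z * g z"
    using Schur_step[OF f(1,2)] by blast
  obtain k where k: "k holomorphic_on ball 0 1" "\<And>z. z \<in> ball 0 1 \<Longrightarrow> cmod (k z) \<le> 1"
    "\<forall>z\<in>ball 0 1. g z * (1 + cnj (g 0) * (z * k z)) = g 0 + z * k z"
    using Schur_step[OF g(1,2)] by blast
  have "fps_expansion \<omega> 0 = fps_X * fps_expansion f 0"
    by (rule fps_eq_on_disc[OF has_fps_expansion_disc[OF hol] _ f(3)])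
      (auto intro!: fps_expansion_intros has_fps_expansion_disc f)
  then have \<omega>: "taylor \<omega> (Suc n) = taylor f n" for n by simp
  note f_c = Schur_step_coefficients[OF f(1) g(1) g(3) refl]
  note g_c = Schur_step_coefficients(1)[OF g(1) k(1) k(3) refl]
  have w: "taylor \<omega> 1 = f 0" "taylor \<omega> 2 = taylor f 1" "taylor \<omega> 3 = taylor f 2"
    using \<omega>[of 0] \<omega>[of 1] \<omega>[of 2] by (simp_all add: taylor_0 numeral_2_eq_2 numeral_3_eq_3)
  show thesis
  proof (rule that[of "g 0" "k 0"])
    show "taylor \<omega> 3 = (1 - (cmod (taylor \<omega> 1))\<^sup>2) * ((1 - (cmod (g 0))\<^sup>2) * k 0 - cnj (taylor \<omega> 1) * (g 0)\<^sup>2)"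
      using f_c(2) g_c by (simp only: w taylor_0)
    show "taylor \<omega> 2 = (1 - (cmod (taylor \<omega> 1))\<^sup>2) * g 0"
      using f_c(1) by (simp only: w taylor_0)
    show "cmod (taylor \<omega> 1) \<le> 1"
      unfolding w by (rule f(2)) simp
  qed (use g(2)[of 0] k(2)[of 0] in simp_all)
qed

text \<open>In this and the next two lemmas, \<open>(1 + \<omega>) / (1 - \<omega>)\<close> is a function of positive real part with second
  and third coefficient \<open>2 (w2 + w1\<^sup>2)\<close> and \<open>2 (w3 + 2 w1 w2 + w1\<^sup>3)\<close>. Caratheodory's bound 2 for
  these is derived from the Schur parameters.\<close>

lemma Caratheodory_2:
  fixes w1 x :: complex
  assumes "cmod w1 \<le> 1" "cmod x \<le> 1"
  shows "cmod ((1 - (cmod w1)\<^sup>2) * x + w1\<^sup>2) \<le> 1"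
proof -
  have u: "0 \<le> 1 - (cmod w1)\<^sup>2" using assms by (simp add: power_le_one)
  have "cmod (complex_of_real (1 - (cmod w1)\<^sup>2) * x + w1\<^sup>2) \<le> (1 - (cmod w1)\<^sup>2) * cmod x + (cmod w1)\<^sup>2"
    using norm_triangle_ineq[of "complex_of_real (1 - (cmod w1)\<^sup>2) * x" "w1\<^sup>2"] u
    unfolding norm_mult norm_power norm_of_real by simp
  also have "\<dots> \<le> 1"
    using mult_left_le[OF assms(2) u] by simp
  finally show ?thesis by simp
qed

text \<open>The plain triangle inequality is too weak here. With \<open>u = 1 - t\<^sup>2\<close>, \<open>e = Re (1 - x)\<close> and
  \<open>D = \<bar>1 - x\<bar>\<^sup>2\<close>, the difference of the squares of \<open>1 - u (1 - \<bar>x\<bar>\<^sup>2)\<close> and of the modulus is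
  \<open>u\<close> times the square of \<open>1 - 2 e + u D\<close>.\<close>

lemma Caratheodory_3_aux:
  fixes t :: real and x :: complex
  assumes t: "0 \<le> t" "t \<le> 1" and x: "cmod x \<le> 1"
  shows "cmod ((1 - t\<^sup>2) * (2 * t * x - t * x\<^sup>2) + t ^ 3) + (1 - t\<^sup>2) * (1 - (cmod x)\<^sup>2) \<le> 1"
proof -
  define u e D where "u = 1 - t\<^sup>2" and "e = Re (1 - x)" and "D = (cmod (1 - x))\<^sup>2"
  have u: "0 \<le> u" "u \<le> 1" using t by (auto simp: u_def power_le_one)
  have x2: "1 - (cmod x)\<^sup>2 = 2 * e - D"
    unfolding e_def D_def cmod_power2 by (simp add: power2_eq_square algebra_simps)
  have eq: "(1 - t\<^sup>2) * (2 * t * x - t * x\<^sup>2) + t ^ 3 = complex_of_real t * (1 - u * (1 - x)\<^sup>2)"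
    by (simp add: u_def power2_eq_square power3_eq_cube algebra_simps)
  have sq: "(cmod (1 - u * (1 - x)\<^sup>2))\<^sup>2 = 1 - 2 * u * (2 * e\<^sup>2 - D) + u\<^sup>2 * D\<^sup>2"
    unfolding e_def D_def cmod_power2 by (simp add: power2_eq_square algebra_simps)
  have pos: "0 \<le> 1 - u * (2 * e - D)"
  proof -
    have "u * (1 - (cmod x)\<^sup>2) \<le> 1 * 1"
      using u x by (intro mult_mono) (auto simp: power_le_one)
    then show ?thesis using x2 by simp
  qed
  have "(cmod ((1 - t\<^sup>2) * (2 * t * x - t * x\<^sup>2) + t ^ 3))\<^sup>2 = t\<^sup>2 * (1 - 2 * u * (2 * e\<^sup>2 - D) + u\<^sup>2 * D\<^sup>2)"
    unfolding eq norm_mult power_mult_distrib sq by simp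
  also have "\<dots> = (1 - u) * (1 - 2 * u * (2 * e\<^sup>2 - D) + u\<^sup>2 * D\<^sup>2)"
    by (simp add: u_def)
  also have "\<dots> = (1 - u * (2 * e - D))\<^sup>2 - u * (1 - 2 * e + u * D)\<^sup>2"
    by (simp add: power2_eq_square algebra_simps)
  also have "\<dots> \<le> (1 - u * (2 * e - D))\<^sup>2"
    using u by simp
  finally have "cmod ((1 - t\<^sup>2) * (2 * t * x - t * x\<^sup>2) + t ^ 3) \<le> 1 - u * (2 * e - D)"
    using pos by (rule power2_le_imp_le)
  then show ?thesis by (simp add: x2 u_def)
qed

text \<open>Replacing \<open>\<omega> z\<close> by \<open>\<omega> (c z)\<close> with \<open>\<bar>c\<bar> = 1\<close> rotates the coefficients; this reduces the claim to
  real \<open>w1\<close>.\<close>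

lemma Caratheodory_3:
  fixes w1 w2 w3 x y :: complex
  assumes w: "cmod w1 \<le> 1" and x: "cmod x \<le> 1" and y: "cmod y \<le> 1"
    and w2: "w2 = (1 - (cmod w1)\<^sup>2) * x"
    and w3: "w3 = (1 - (cmod w1)\<^sup>2) * ((1 - (cmod x)\<^sup>2) * y - cnj w1 * x\<^sup>2)"
  shows "cmod (w3 + 2 * w1 * w2 + w1 ^ 3) \<le> 1"
proof -
  define t where "t = cmod w1"
  \<comment> \<open>For \<open>w1 = 0\<close> any rotation will do, but \<open>sgn w1\<close> would not be one.\<close>
  define e where "e = (if w1 = 0 then 1 else sgn w1)"
  define x' where "x' = x * (cnj e)\<^sup>2"
  have e: "cmod e = 1" by (simp add: e_def norm_sgn)
  then have ee: "e * cnj e = 1" using complex_norm_square[of e] by simp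
  have w1: "w1 = t * e" by (simp add: e_def t_def sgn_eq)
  have x': "cmod x' = cmod x" using e by (simp add: x'_def norm_mult norm_power)
  have xx': "x = e\<^sup>2 * x'"
  proof -
    have "e\<^sup>2 * x' = (e * cnj e)\<^sup>2 * x" by (simp only: x'_def power_mult_distrib mult_ac)
    then show ?thesis using ee by simp
  qed
  have "w3 + 2 * w1 * w2 + w1 ^ 3 =
      e ^ 3 * ((1 - t\<^sup>2) * (2 * t * x' - t * x'\<^sup>2) + t ^ 3) + complex_of_real ((1 - t\<^sup>2) * (1 - (cmod x)\<^sup>2)) * y"
  proof -
    have "cnj w1 * x\<^sup>2 = e ^ 3 * (t * x'\<^sup>2) * (e * cnj e)"
      unfolding w1 xx' by (simp add: power2_eq_square power3_eq_cube mult_ac)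
    then have "cnj w1 * x\<^sup>2 = e ^ 3 * (t * x'\<^sup>2)" using ee by simp
    moreover have "w1 * x = e ^ 3 * (t * x')" "w1 ^ 3 = e ^ 3 * t ^ 3"
      unfolding w1 xx' by (simp_all add: power2_eq_square power3_eq_cube mult_ac)
    moreover have "w3 + 2 * w1 * w2 + w1 ^ 3 = (1 - t\<^sup>2) * (2 * (w1 * x) - cnj w1 * x\<^sup>2) + w1 ^ 3
        + complex_of_real ((1 - t\<^sup>2) * (1 - (cmod x)\<^sup>2)) * y"
      unfolding w2 w3 t_def[symmetric] by (simp add: algebra_simps)
    ultimately show ?thesis by (simp add: algebra_simps)
  qed
  moreover have "cmod (e ^ 3 * ((1 - t\<^sup>2) * (2 * t * x' - t * x'\<^sup>2) + t ^ 3))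
      = cmod ((1 - t\<^sup>2) * (2 * t * x' - t * x'\<^sup>2) + t ^ 3)"
    using e by (simp add: norm_mult norm_power)
  moreover have "cmod (complex_of_real ((1 - t\<^sup>2) * (1 - (cmod x)\<^sup>2)) * y) \<le> (1 - t\<^sup>2) * (1 - (cmod x)\<^sup>2)"
  proof -
    have "0 \<le> (1 - t\<^sup>2) * (1 - (cmod x)\<^sup>2)"
      using w x by (intro mult_nonneg_nonneg) (auto simp: t_def power_le_one)
    then show ?thesis
      unfolding norm_mult norm_of_real using y by (simp add: mult_left_le)
  qed
  ultimately show ?thesis
    using Caratheodory_3_aux[of t x'] w x x'
      norm_triangle_ineq[of "e ^ 3 * ((1 - t\<^sup>2) * (2 * t * x' - t * x'\<^sup>2) + t ^ 3)"
        "complex_of_real ((1 - t\<^sup>2) * (1 - (cmod x)\<^sup>2)) * y"]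
    by (simp add: t_def)
qed

text \<open>The expression is \<open>(a\<^sup>2 + a c - 2 b\<^sup>2) / \<beta>\<^sup>2\<close> for the coefficients \<open>a, b, c\<close> of a starlike function
  of order \<open>1 - \<beta>\<close>. After the triangle inequality only \<open>r = \<bar>x\<bar>\<close> and \<open>T = \<bar>w1\<bar>\<^sup>2\<close> matter; the
  resulting bound increases in both, and at \<open>T = 1\<close> it equals \<open>4 + K\<close>.\<close>

lemma second_factor_bound:
  fixes w1 w2 w3 x y :: complex and \<beta> :: real
  assumes \<beta>: "0 \<le> \<beta>" and w: "cmod w1 \<le> 1" and x: "cmod x \<le> 1" and y: "cmod y \<le> 1"
    and w2: "w2 = (1 - (cmod w1)\<^sup>2) * x"
    and w3: "w3 = (1 - (cmod w1)\<^sup>2) * ((1 - (cmod x)\<^sup>2) * y - cnj w1 * x\<^sup>2)"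
  defines "K \<equiv> 2 / 3 + 4 * \<beta> + 16 / 3 * \<beta>\<^sup>2"
  shows "cmod (4 * w1\<^sup>2 + 4 / 3 * w1 * w3 - (4 / 3 + 4 * \<beta>) * w1\<^sup>2 * w2 - 2 * w2\<^sup>2 - K * w1 ^ 4) \<le> 4 + K"
proof -
  define t r u T where "t = cmod w1" and "r = cmod x" and "u = 1 - t\<^sup>2" and "T = t\<^sup>2"
  have t: "0 \<le> t" "t \<le> 1" and r: "0 \<le> r" "r \<le> 1" using w x by (auto simp: t_def r_def)
  have u: "0 \<le> u" "u \<le> 1" using t by (auto simp: u_def power_le_one)
  have K: "0 \<le> K" using \<beta> by (simp add: K_def)
  have ww: "w1 * cnj w1 = complex_of_real (t\<^sup>2)" unfolding t_def by (simp only: complex_norm_square)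
  define c where "c = 2 - 2 / 3 * t\<^sup>2"
  have c: "0 \<le> c" using t power_le_one[of t 2] by (simp add: c_def)
  let ?a = "4 * w1\<^sup>2" let ?b = "complex_of_real (4 / 3 * u * (1 - r\<^sup>2)) * (w1 * y)"
  let ?c = "complex_of_real (u * c) * x\<^sup>2" let ?d = "complex_of_real ((4 / 3 + 4 * \<beta>) * u) * (w1\<^sup>2 * x)"
  let ?e = "complex_of_real K * w1 ^ 4"
  have split: "4 * w1\<^sup>2 + 4 / 3 * w1 * w3 - (4 / 3 + 4 * \<beta>) * w1\<^sup>2 * w2 - 2 * w2\<^sup>2 - K * w1 ^ 4
      = ?a + ?b - ?c - ?d - ?e"
  proof -
    have "w1 * w3 = u * (1 - r\<^sup>2) * (w1 * y) - u * (w1 * cnj w1) * x\<^sup>2"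
      unfolding w3 u_def r_def t_def by (simp add: algebra_simps)
    then have "w1 * w3 = complex_of_real (u * (1 - r\<^sup>2)) * (w1 * y) - complex_of_real (u * t\<^sup>2) * x\<^sup>2"
      unfolding ww by simp
    moreover have "w2 = u * x" unfolding w2 u_def t_def by simp
    moreover have "complex_of_real (u * c) = 2 * u\<^sup>2 + 4 / 3 * (u * t\<^sup>2)"
      by (simp add: c_def u_def power2_eq_square field_simps)
    ultimately show ?thesis
      by (simp only: mult.assoc[of "4 / 3"] right_diff_distrib)
        (simp add: algebra_simps power2_eq_square)
  qed
  have "cmod (?a + ?b - ?c - ?d - ?e) \<le> cmod ?a + cmod ?b + cmod ?c + cmod ?d + cmod ?e"
    by norm
  also have "\<dots> \<le> 4 * T + 4 / 3 * u * (1 - r\<^sup>2) * t + u * c * r\<^sup>2 + (4 / 3 + 4 * \<beta>) * u * (T * r) + K * T\<^sup>2"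
  proof (intro add_mono)
    show "cmod ?a \<le> 4 * T" by (simp add: norm_mult norm_power T_def t_def)
    show "cmod ?e \<le> K * T\<^sup>2"
      using K by (simp add: norm_mult norm_power T_def t_def flip: power_mult)
    show "cmod ?c \<le> u * c * r\<^sup>2"
      unfolding norm_mult[of "complex_of_real _"] norm_of_real norm_power using u c by (simp add: r_def abs_mult)
    show "cmod ?d \<le> (4 / 3 + 4 * \<beta>) * u * (T * r)"
      unfolding norm_mult norm_of_real norm_power using u \<beta> by (simp add: r_def T_def t_def abs_mult)
    have p: "0 \<le> 4 / 3 * u * (1 - r\<^sup>2)" using u r by (simp add: power_le_one)
    show "cmod ?b \<le> 4 / 3 * u * (1 - r\<^sup>2) * t"
      unfolding norm_mult norm_of_real abs_of_nonneg[OF p]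
      using p y t by (intro mult_left_mono) (auto simp: t_def mult_left_le)
  qed
  also have "\<dots> \<le> 4 * T + u * c + (4 / 3 + 4 * \<beta>) * u * T + K * T\<^sup>2"
  proof -
    \<comment> \<open>Since \<open>3 c - 4 t = 2 (1 - t) (3 + t)\<close>, the left side increases with \<open>r\<close>.\<close>
    have "0 \<le> u * (1 - r\<^sup>2) * (2 / 3 * (1 - t) * (3 + t))"
      using u r t by (intro mult_nonneg_nonneg) (auto simp: power_le_one)
    also have "\<dots> = u * c - 4 / 3 * u * (1 - r\<^sup>2) * t - u * c * r\<^sup>2"
      by (simp add: c_def power2_eq_square field_simps)
    finally have "4 / 3 * u * (1 - r\<^sup>2) * t + u * c * r\<^sup>2 \<le> u * c" by simp
    moreover have "(4 / 3 + 4 * \<beta>) * u * (T * r) \<le> (4 / 3 + 4 * \<beta>) * u * T"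
      using u \<beta> r by (intro mult_left_mono) (auto simp: T_def mult_left_le)
    ultimately show ?thesis by linarith
  qed
  also have "\<dots> = 2 + (8 / 3 + 4 * \<beta>) * T + 16 / 3 * \<beta>\<^sup>2 * T\<^sup>2"
    by (simp add: u_def c_def T_def K_def power2_eq_square field_simps)
  also have "\<dots> \<le> 2 + (8 / 3 + 4 * \<beta>) * 1 + 16 / 3 * \<beta>\<^sup>2 * 1"
    using \<beta> t by (intro add_mono mult_left_mono) (auto simp: T_def power_le_one)
  also have "\<dots> = 4 + K" by (simp add: K_def)
  finally show ?thesis unfolding split .
qed

section \<open>Starlike functions of the unit disk\<close>

text \<open>The determinant of the symmetric Toeplitz matrix with first row \<open>a, b, c\<close>. The factorization below
  separates symmetric and antisymmetric eigenvectors.\<close>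

definition toeplitz_det :: "complex \<Rightarrow> complex \<Rightarrow> complex \<Rightarrow> complex"
  where "toeplitz_det a b c = a ^ 3 - 2 * a * b\<^sup>2 - a * c\<^sup>2 + 2 * b\<^sup>2 * c"

lemma toeplitz_det_factor: "toeplitz_det a b c = (a - c) * (a\<^sup>2 + a * c - 2 * b\<^sup>2)"
  by (simp add: toeplitz_det_def power2_eq_square power3_eq_cube algebra_simps)

definition det_bound :: "real \<Rightarrow> real"
  where "det_bound \<alpha> = 4 / 9 * (1 - \<alpha>) ^ 3 * (2 * \<alpha>\<^sup>2 - 7 * \<alpha> + 9) * (8 * \<alpha>\<^sup>2 - 22 * \<alpha> + 21)"

lemma det_bound_eq:
  assumes "\<beta> = 1 - \<alpha>"
  shows "det_bound \<alpha> = (2 / 3 * \<beta> * (2 * \<beta>\<^sup>2 + 3 * \<beta> + 4)) * (\<beta>\<^sup>2 * (4 + (2 / 3 + 4 * \<beta> + 16 / 3 * \<beta>\<^sup>2)))"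
proof -
  have \<alpha>: "\<alpha> = 1 - \<beta>" using assms by simp
  show ?thesis
    unfolding det_bound_def \<alpha> by (simp add: power2_eq_square power3_eq_cube field_simps)
qed

text \<open>Comparison of coefficients in \<open>z h' (1 - \<omega>) = 2 \<beta> \<omega> h\<close>. The result is grouped so that the
  Caratheodory expressions in the coefficients of \<open>\<omega>\<close> appear.\<close>

lemma starlike_coefficients:
  fixes \<beta> :: real and h \<omega> :: "complex \<Rightarrow> complex" and w :: "nat \<Rightarrow> complex"
  assumes hol: "h holomorphic_on ball 0 1" "\<omega> holomorphic_on ball 0 1" and "h 0 = 1" "\<omega> 0 = 0"
    and eq: "\<forall>z\<in>ball 0 1. z * deriv h z * (1 - \<omega> z) = 2 * complex_of_real \<beta> * \<omega> z * h z"
  defines "w \<equiv> taylor \<omega>"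
  shows "taylor h 1 = 2 * \<beta> * w 1"
    and "taylor h 2 = \<beta> * (w 2 + (w 1)\<^sup>2) + 2 * \<beta>\<^sup>2 * (w 1)\<^sup>2"
    and "taylor h 3 = 4 / 3 * \<beta> ^ 3 * (w 1) ^ 3 + 2 * \<beta>\<^sup>2 * w 1 * (w 2 + (w 1)\<^sup>2)
      + 2 / 3 * \<beta> * (w 3 + 2 * w 1 * w 2 + (w 1) ^ 3)"
proof -
  define H where "H = fps_expansion h 0"
  define W where "W = fps_expansion \<omega> 0"
  note exp = hol[THEN has_fps_expansion_disc, folded H_def W_def]
  have "fps_X * fps_deriv H * (1 - W) = fps_const (2 * complex_of_real \<beta>) * W * H"
    by (rule fps_eq_on_disc[OF _ _ bspec[OF eq]]) (auto intro!: fps_expansion_intros exp)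
  then have nth: "fps_nth (fps_X * (fps_deriv H * (1 - W))) n = fps_nth (fps_const (2 * complex_of_real \<beta>) * (W * H)) n" for n
    by (simp add: mult.assoc)
  have zero: "fps_nth H 0 = 1" "fps_nth W 0 = 0"
    using assms(3,4) taylor_0[of h] taylor_0[of \<omega>] by (simp_all add: H_def W_def)
  have w: "w n = fps_nth W n" for n by (simp add: w_def W_def)
  show c1: "taylor h 1 = 2 * \<beta> * w 1"
    using nth[of 1] zero by (simp add: w H_def[symmetric] fps_mult_nth)
  have c2: "2 * fps_nth H 2 = fps_nth H 1 * w 1 + 2 * \<beta> * (w 2 + w 1 * fps_nth H 1)"
    using nth[of 2] zero by (simp add: w fps_mult_nth numeral_2_eq_2 algebra_simps)
  have c3: "3 * fps_nth H 3 = 2 * fps_nth H 2 * w 1 + fps_nth H 1 * w 2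
      + 2 * \<beta> * (w 3 + w 2 * fps_nth H 1 + w 1 * fps_nth H 2)"
    using nth[of 3] zero by (simp add: w fps_mult_nth numeral_2_eq_2 numeral_3_eq_3 algebra_simps)
  show c2': "taylor h 2 = \<beta> * (w 2 + (w 1)\<^sup>2) + 2 * \<beta>\<^sup>2 * (w 1)\<^sup>2"
  proof -
    have "2 * taylor h 2 = 2 * (\<beta> * (w 2 + (w 1)\<^sup>2) + 2 * \<beta>\<^sup>2 * (w 1)\<^sup>2)"
      using c2 c1 by (simp add: H_def[symmetric] power2_eq_square algebra_simps)
    then show ?thesis unfolding mult_cancel_left by simp
  qed
  have "3 * taylor h 3 = 3 * (4 / 3 * \<beta> ^ 3 * (w 1) ^ 3 + 2 * \<beta>\<^sup>2 * w 1 * (w 2 + (w 1)\<^sup>2)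
      + 2 / 3 * \<beta> * (w 3 + 2 * w 1 * w 2 + (w 1) ^ 3))"
    unfolding H_def[symmetric] c3 using c1 c2'
    by (simp add: H_def[symmetric] power2_eq_square power3_eq_cube algebra_simps)
  then show "taylor h 3 = 4 / 3 * \<beta> ^ 3 * (w 1) ^ 3 + 2 * \<beta>\<^sup>2 * w 1 * (w 2 + (w 1)\<^sup>2)
      + 2 / 3 * \<beta> * (w 3 + 2 * w 1 * w 2 + (w 1) ^ 3)"
    unfolding mult_cancel_left by simp
qed

text \<open>The Schwarz function is \<open>\<omega> = P / (P + 2 \<beta>)\<close> for \<open>P = z h' / h\<close>: the condition \<open>Re P > - \<beta>\<close> says that
  \<open>P\<close> is closer to \<open>0\<close> than to \<open>- 2 \<beta>\<close>.\<close>

theorem starlike_toeplitz_det_bound: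
  assumes \<alpha>: "\<alpha> < 1" and hol: "h holomorphic_on ball 0 1" and h0: "h 0 = 1"
    and nz: "\<And>z. z \<in> ball 0 1 \<Longrightarrow> h z \<noteq> 0"
    and star: "\<And>z. z \<in> ball 0 1 \<Longrightarrow> Re (1 + z * deriv h z / h z) > \<alpha>"
  shows "cmod (toeplitz_det (taylor h 1) (taylor h 2) (taylor h 3)) \<le> det_bound \<alpha>"
proof -
  define \<beta> where "\<beta> = 1 - \<alpha>"
  have \<beta>: "\<beta> > 0" using \<alpha> by (simp add: \<beta>_def)
  define P where "P z = z * deriv h z / h z" for z
  define \<omega> where "\<omega> z = P z / (P z + 2 * \<beta>)" for z
  have P_Re: "Re (P z) > - \<beta>" if "z \<in> ball 0 1" for z
    using star[OF that] by (simp add: P_def \<beta>_def)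
  have less: "cmod (P z) < cmod (P z + 2 * \<beta>)" if "z \<in> ball 0 1" for z
  proof (rule power2_less_imp_less)
    have "0 < 4 * \<beta> * (Re (P z) + \<beta>)" using P_Re[OF that] \<beta> by simp
    then show "(cmod (P z))\<^sup>2 < (cmod (P z + 2 * \<beta>))\<^sup>2"
      unfolding cmod_power2 by (simp add: power2_eq_square algebra_simps)
  qed simp
  have denom: "P z + 2 * \<beta> \<noteq> 0" if "z \<in> ball 0 1" for z
    using less[OF that] by auto
  have "P holomorphic_on ball 0 1"
    unfolding P_def[abs_def] using nz by (intro holomorphic_intros hol) auto
  then have \<omega>_hol: "\<omega> holomorphic_on ball 0 1"
    unfolding \<omega>_def[abs_def] using denom by (intro holomorphic_intros) auto
  have \<omega>_0: "\<omega> 0 = 0" by (simp add: \<omega>_def P_def)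
  have \<omega>_le: "cmod (\<omega> z) \<le> 1" if "z \<in> ball 0 1" for z
    using less[OF that] denom[OF that] by (simp add: \<omega>_def norm_divide)
  have eq: "\<forall>z\<in>ball 0 1. z * deriv h z * (1 - \<omega> z) = 2 * complex_of_real \<beta> * \<omega> z * h z"
  proof
    fix z :: complex assume that: "z \<in> ball 0 1"
    have "P z * (1 - \<omega> z) = 2 * \<beta> * \<omega> z"
      using denom[OF that] by (simp add: \<omega>_def field_simps)
    moreover have "z * deriv h z = P z * h z" using nz[OF that] by (simp add: P_def)
    ultimately show "z * deriv h z * (1 - \<omega> z) = 2 * complex_of_real \<beta> * \<omega> z * h z"
      by (simp add: mult_ac)
  qed
  define w1 w2 w3 where "w1 = taylor \<omega> 1" and "w2 = taylor \<omega> 2" and "w3 = taylor \<omega> 3"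
  obtain x y :: complex where xy: "cmod w1 \<le> 1" "cmod x \<le> 1" "cmod y \<le> 1"
    and w2: "w2 = (1 - (cmod w1)\<^sup>2) * x"
    and w3: "w3 = (1 - (cmod w1)\<^sup>2) * ((1 - (cmod x)\<^sup>2) * y - cnj w1 * x\<^sup>2)"
    using Schwarz_coefficients[OF \<omega>_hol \<omega>_0 \<omega>_le] unfolding w1_def w2_def w3_def by metis
  note coeffs = starlike_coefficients[OF hol \<omega>_hol h0 \<omega>_0 eq, folded w1_def w2_def w3_def]
  let ?a = "taylor h 1" let ?b = "taylor h 2" let ?c = "taylor h 3"
  have C2: "cmod (w2 + w1\<^sup>2) \<le> 1" using Caratheodory_2[OF xy(1,2)] w2 by simp
  have C3: "cmod (w3 + 2 * w1 * w2 + w1 ^ 3) \<le> 1" by (rule Caratheodory_3[OF xy w2 w3])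
  have "cmod (?a - ?c) \<le> 2 / 3 * \<beta> * (2 * \<beta>\<^sup>2 + 3 * \<beta> + 4)"
  proof -
    let ?r = "complex_of_real (2 * \<beta>) * w1" let ?s = "complex_of_real (4 / 3 * \<beta> ^ 3) * w1 ^ 3"
    let ?t = "complex_of_real (2 * \<beta>\<^sup>2) * (w1 * (w2 + w1\<^sup>2))"
    let ?u = "complex_of_real (2 / 3 * \<beta>) * (w3 + 2 * w1 * w2 + w1 ^ 3)"
    have split: "?a - ?c = ?r - ?s - ?t - ?u"
      unfolding coeffs by (simp add: algebra_simps)
    have "cmod (?r - ?s - ?t - ?u) \<le> cmod ?r + cmod ?s + cmod ?t + cmod ?u"
      by norm
    also have "\<dots> \<le> 2 * \<beta> * 1 + 4 / 3 * \<beta> ^ 3 * 1 + 2 * \<beta>\<^sup>2 * (1 * 1) + 2 / 3 * \<beta> * 1"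
      unfolding norm_mult[of "complex_of_real _"] norm_of_real norm_mult[of w1] norm_power
      using \<beta> xy C2 C3 by (intro add_mono mult_mono) (auto simp: power_le_one)
    also have "\<dots> = 2 / 3 * \<beta> * (2 * \<beta>\<^sup>2 + 3 * \<beta> + 4)"
      by (simp add: power2_eq_square power3_eq_cube algebra_simps)
    finally show ?thesis unfolding split .
  qed
  moreover have "cmod (?a\<^sup>2 + ?a * ?c - 2 * ?b\<^sup>2) \<le> \<beta>\<^sup>2 * (4 + (2 / 3 + 4 * \<beta> + 16 / 3 * \<beta>\<^sup>2))"
  proof -
    have "?a\<^sup>2 + ?a * ?c - 2 * ?b\<^sup>2 = complex_of_real (\<beta>\<^sup>2) *
        (4 * w1\<^sup>2 + 4 / 3 * w1 * w3 - (4 / 3 + 4 * \<beta>) * w1\<^sup>2 * w2 - 2 * w2\<^sup>2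
          - (2 / 3 + 4 * \<beta> + 16 / 3 * \<beta>\<^sup>2) * w1 ^ 4)"
      unfolding coeffs by (simp add: power2_eq_square power3_eq_cube power4_eq_xxxx algebra_simps)
    then show ?thesis
      using second_factor_bound[OF less_imp_le[OF \<beta>] xy w2 w3] \<beta>
      by (simp add: norm_mult norm_power mult_left_mono)
  qed
  ultimately show ?thesis
    unfolding toeplitz_det_factor norm_mult det_bound_eq[OF \<beta>_def]
    using \<beta> by (intro mult_mono) auto
qed

text \<open>For \<open>\<omega> z = \<i> z\<close> the coefficients are \<open>\<i>\<close>, \<open>0\<close>, \<open>0\<close>, and all triangle inequalities above become
  equalities: the factor \<open>\<i>\<close> gives the coefficients \<open>a\<close> and \<open>c\<close> opposite signs.\<close>

theorem starlike_toeplitz_det_extremal: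
  assumes \<alpha>: "\<alpha> < 1" and hol: "h holomorphic_on ball 0 1" and h0: "h 0 = 1"
    and eq: "\<And>z. z \<in> ball 0 1 \<Longrightarrow> z * deriv h z * (1 - \<i> * z) = 2 * complex_of_real (1 - \<alpha>) * (\<i> * z) * h z"
  shows "cmod (toeplitz_det (taylor h 1) (taylor h 2) (taylor h 3)) = det_bound \<alpha>"
proof -
  define \<beta> where "\<beta> = 1 - \<alpha>"
  have \<beta>: "\<beta> > 0" using \<alpha> by (simp add: \<beta>_def)
  have \<omega>: "(\<lambda>z::complex. \<i> * z) holomorphic_on ball 0 1" by (intro holomorphic_intros)
  have "fps_expansion (\<lambda>z. \<i> * z) 0 = fps_const \<i> * fps_X"
    by (rule fps_eq_on_disc[OF has_fps_expansion_disc[OF \<omega>], where g="\<lambda>z. \<i> * z"])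
      (auto intro!: fps_expansion_intros)
  then have w: "taylor (\<lambda>z. \<i> * z) 1 = \<i>" "taylor (\<lambda>z. \<i> * z) 2 = 0" "taylor (\<lambda>z. \<i> * z) 3 = 0"
    by simp_all
  have "\<forall>z\<in>ball 0 1. z * deriv h z * (1 - \<i> * z) = 2 * complex_of_real \<beta> * (\<i> * z) * h z"
    using eq by (simp add: \<beta>_def)
  note coeffs = starlike_coefficients[OF hol \<omega> h0 mult_zero_right this, unfolded w]
  let ?a = "taylor h 1" let ?b = "taylor h 2" let ?c = "taylor h 3"
  have "?a - ?c = \<i> * complex_of_real (2 / 3 * \<beta> * (2 * \<beta>\<^sup>2 + 3 * \<beta> + 4))"
    unfolding coeffs by (simp add: power2_eq_square power3_eq_cube field_simps)
  then have 1: "cmod (?a - ?c) = 2 / 3 * \<beta> * (2 * \<beta>\<^sup>2 + 3 * \<beta> + 4)"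
    using \<beta> by (simp only: norm_mult norm_of_real) simp
  have "?a\<^sup>2 + ?a * ?c - 2 * ?b\<^sup>2 = - complex_of_real (\<beta>\<^sup>2 * (4 + (2 / 3 + 4 * \<beta> + 16 / 3 * \<beta>\<^sup>2)))"
    unfolding coeffs by (simp add: power2_eq_square power3_eq_cube field_simps)
  then have "cmod (?a\<^sup>2 + ?a * ?c - 2 * ?b\<^sup>2) = \<beta>\<^sup>2 * (4 + (2 / 3 + 4 * \<beta> + 16 / 3 * \<beta>\<^sup>2))"
    using \<beta> by (simp only: norm_minus_cancel norm_of_real) simp
  with 1 show ?thesis
    unfolding toeplitz_det_factor norm_mult det_bound_eq[OF \<beta>_def] by (simp only:)
qed

section \<open>Starlike mappings with a scalar multiplier\<close>

lemma has_derivative_multiplier: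
  fixes f :: "'a::complex_banach \<Rightarrow> complex"
  assumes "(f has_derivative D) (at z)"
  shows "((\<lambda>z. f z *\<^sub>C z) has_derivative (\<lambda>v. f z *\<^sub>C v + D v *\<^sub>C z)) (at z)"
  using bounded_bilinear.FDERIV[OF bounded_bilinear_scaleC assms has_derivative_ident] by simp

lemma cholomorphic_multiplier:
  fixes f :: "'a::complex_banach \<Rightarrow> complex"
  assumes f: "cholomorphic_on (ball 0 1) f"
  shows "cholomorphic_on (ball 0 1) (\<lambda>z. f z *\<^sub>C z)"
    and "z \<in> ball 0 1 \<Longrightarrow> blinfun_apply (fderiv (\<lambda>z. f z *\<^sub>C z) z) v
      = f z *\<^sub>C v + blinfun_apply (fderiv f z) v *\<^sub>C z"
proof -
  have D: "((\<lambda>z. f z *\<^sub>C z) has_derivative (\<lambda>v. f z *\<^sub>C v + blinfun_apply (fderiv f z) v *\<^sub>C z)) (at z)"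
    if "z \<in> ball 0 1" for z
    by (rule has_derivative_multiplier[OF cholomorphic_on_fderiv(1)[OF f that]])
  show "cholomorphic_on (ball 0 1) (\<lambda>z. f z *\<^sub>C z)"
    unfolding cholomorphic_on_def
  proof
    fix z :: 'a assume z: "z \<in> ball 0 1"
    have "bounded_clinear (\<lambda>v. f z *\<^sub>C v + blinfun_apply (fderiv f z) v *\<^sub>C z)"
      using has_derivative_bounded_linear[OF D[OF z]] cholomorphic_on_fderiv(2)[OF f z]
      by (simp add: bounded_clinear_def scaleC_add_right scaleC_scaleC mult.commute scaleC_complex_def)
    with D[OF z] show "\<exists>D. bounded_clinear D \<and> ((\<lambda>z. f z *\<^sub>C z) has_derivative D) (at z)" by blast
  qed
  show "z \<in> ball 0 1 \<Longrightarrow> blinfun_apply (fderiv (\<lambda>z. f z *\<^sub>C z) z) v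
      = f z *\<^sub>C v + blinfun_apply (fderiv f z) v *\<^sub>C z"
    using fderiv_eqI[OF D] by simp
qed

text \<open>On multiples of \<open>z\<close> the derivative acts as multiplication by \<open>p = f z + Df(z) z\<close>, and injectivity
  forces \<open>p \<noteq> 0\<close>.\<close>

lemma inv_fderiv_multiplier:
  fixes f :: "'a::complex_banach \<Rightarrow> complex"
  assumes f: "cholomorphic_on (ball 0 1) f" and z: "z \<in> ball 0 1" "z \<noteq> 0"
    and bij: "bij (blinfun_apply (fderiv (\<lambda>z. f z *\<^sub>C z) z))"
  shows "inv (blinfun_apply (fderiv (\<lambda>z. f z *\<^sub>C z) z)) (f z *\<^sub>C z)
    = (f z / (f z + blinfun_apply (fderiv f z) z)) *\<^sub>C z"
proof -
  define p where "p = f z + blinfun_apply (fderiv f z) z"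
  let ?D = "blinfun_apply (fderiv (\<lambda>z. f z *\<^sub>C z) z)"
  have D: "?D (c *\<^sub>C z) = (c * p) *\<^sub>C z" for c
    using cholomorphic_multiplier(2)[OF f z(1), of "c *\<^sub>C z"] cholomorphic_on_fderiv(2)[OF f z(1), of c z]
    by (simp add: p_def scaleC_scaleC scaleC_add_left[symmetric] scaleC_complex_def algebra_simps)
  have "p \<noteq> 0"
  proof
    assume "p = 0"
    then have "?D z = ?D 0" using D[of 1] by (simp add: scaleC_one blinfun.zero_right)
    then show False using injD[OF bij_is_inj[OF bij]] z(2) by blast
  qed
  then have "?D ((f z / p) *\<^sub>C z) = f z *\<^sub>C z" by (simp add: D)
  then show ?thesis
    using bij by (simp add: p_def bij_def inv_f_eq)
qed

text \<open>The two forms of the defining condition, for \<open>\<alpha> > 0\<close> and for \<open>\<alpha> = 0\<close>, both say that the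
  reciprocal has real part greater than \<open>\<alpha>\<close>.\<close>

lemma Phi_0_image: "p \<in> Phi 0 ` ball 0 1 \<longleftrightarrow> Re p > 0"
proof
  assume "p \<in> Phi 0 ` ball 0 1"
  then obtain \<zeta> where \<zeta>: "cmod \<zeta> < 1" and p: "p = (1 + \<zeta>) / (1 - \<zeta>)"
    by (auto simp: Phi_def)
  have "Re ((1 + \<zeta>) * cnj (1 - \<zeta>)) = 1 - (cmod \<zeta>)\<^sup>2"
    unfolding cmod_power2 by (simp add: power2_eq_square algebra_simps)
  moreover have "(cmod \<zeta>)\<^sup>2 < 1"
    using power_strict_mono[OF \<zeta> norm_ge_zero, of 2] by simp
  ultimately have "Re ((1 + \<zeta>) * cnj (1 - \<zeta>)) > 0" by linarith
  then show "Re p > 0"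
    by (simp only: p Re_complex_div_gt_0)
next
  assume p: "Re p > 0"
  then have nz: "p + 1 \<noteq> 0" by (auto simp: complex_eq_iff)
  define \<zeta> where "\<zeta> = (p - 1) / (p + 1)"
  have "(cmod (p - 1))\<^sup>2 < (cmod (p + 1))\<^sup>2"
    using p unfolding cmod_power2 by (simp add: power2_eq_square algebra_simps)
  then have "cmod (p - 1) < cmod (p + 1)" by (rule power2_less_imp_less) simp
  then have "cmod \<zeta> < 1" using nz by (simp add: \<zeta>_def norm_divide)
  moreover have "Phi 0 \<zeta> = p"
  proof -
    have "1 + \<zeta> = 2 * p / (p + 1)" "1 - \<zeta> = 2 / (p + 1)"
      using nz by (simp_all add: \<zeta>_def field_simps)
    then show ?thesis using nz by (simp add: Phi_def)
  qed
  ultimately show "p \<in> Phi 0 ` ball 0 1" by auto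
qed

lemma reciprocal_half_plane:
  assumes "\<alpha> > 0"
  shows "cmod (c - 1 / (2 * complex_of_real \<alpha>)) < 1 / (2 * \<alpha>) \<longleftrightarrow> Re (1 / c) > \<alpha>"
proof -
  have "cmod (c - 1 / (2 * complex_of_real \<alpha>)) < 1 / (2 * \<alpha>)
      \<longleftrightarrow> (cmod (c - complex_of_real (1 / (2 * \<alpha>))))\<^sup>2 < (1 / (2 * \<alpha>))\<^sup>2"
    using assms power_strict_mono[of "cmod (c - complex_of_real (1 / (2 * \<alpha>)))" "1 / (2 * \<alpha>)" 2]
      power2_less_imp_less[of "cmod (c - complex_of_real (1 / (2 * \<alpha>)))" "1 / (2 * \<alpha>)"] by auto
  also have "(cmod (c - complex_of_real (1 / (2 * \<alpha>))))\<^sup>2 = (Re c)\<^sup>2 + (Im c)\<^sup>2 - Re c / \<alpha> + (1 / (2 * \<alpha>))\<^sup>2"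
    unfolding cmod_power2 by (simp add: power2_eq_square algebra_simps)
  also have "\<dots> < (1 / (2 * \<alpha>))\<^sup>2 \<longleftrightarrow> \<alpha> * ((Re c)\<^sup>2 + (Im c)\<^sup>2) < Re c"
    using assms pos_less_divide_eq[of \<alpha> "(Re c)\<^sup>2 + (Im c)\<^sup>2" "Re c"] by (simp add: mult.commute)
  also have "\<dots> \<longleftrightarrow> Re (1 / c) > \<alpha>"
  proof (cases "c = 0")
    case False
    then have "(Re c)\<^sup>2 + (Im c)\<^sup>2 > 0" by (simp add: complex_neq_0)
    then show ?thesis by (simp add: Re_divide field_simps)
  qed (use assms in simp)
  finally show ?thesis .
qed

text \<open>The condition that \<open>starlike_of_order\<close> imposes at a single point and functional.\<close>

definition starlike_condition :: "real \<Rightarrow> ('a::complex_banach \<Rightarrow> 'a) \<Rightarrow> 'a \<Rightarrow> ('a \<Rightarrow> complex) \<Rightarrow> bool"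
  where "starlike_condition \<alpha> F z l \<longleftrightarrow>
    (let w = l (inv (blinfun_apply (fderiv F z)) (F z)) in
      if \<alpha> = 0 then complex_of_real (norm z) / w \<in> Phi 0 ` ball 0 1
      else cmod (w / complex_of_real (norm z) - 1 / (2 * complex_of_real \<alpha>)) < 1 / (2 * \<alpha>))"

text \<open>For these mappings the support functional drops out of the condition: \<open>[DF(z)]\<^sup>-\<^sup>1 F(z)\<close> is a
  multiple of \<open>z\<close>, on which every support functional takes the same value.\<close>

lemma starlike_condition_multiplier:
  fixes f :: "'a::complex_banach \<Rightarrow> complex"
  assumes \<alpha>: "\<alpha> \<ge> 0" and f: "cholomorphic_on (ball 0 1) f" and z: "z \<in> ball 0 1" "z \<noteq> 0"
    and bij: "bij (blinfun_apply (fderiv (\<lambda>z. f z *\<^sub>C z) z))" and l: "l \<in> support_functionals z"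
  shows "starlike_condition \<alpha> (\<lambda>z. f z *\<^sub>C z) z l \<longleftrightarrow>
    Re ((f z + blinfun_apply (fderiv f z) z) / f z) > \<alpha>"
proof -
  define c where "c = f z / (f z + blinfun_apply (fderiv f z) z)"
  have l': "bounded_clinear l" "l z = norm z" using l by (auto simp: support_functionals_def)
  have "l (inv (blinfun_apply (fderiv (\<lambda>z. f z *\<^sub>C z) z)) (f z *\<^sub>C z)) = c * norm z"
    unfolding inv_fderiv_multiplier[OF f z bij] bounded_clinear_cmult[OF l'(1)] l'(2) c_def ..
  then have "starlike_condition \<alpha> (\<lambda>z. f z *\<^sub>C z) z l \<longleftrightarrow> Re (1 / c) > \<alpha>"
    using z(2) \<alpha> reciprocal_half_plane[of \<alpha> c]
    by (simp add: starlike_condition_def Let_def Phi_0_image divide_simps)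
  then show ?thesis by (simp add: c_def)
qed

lemma starlike_of_order_iff:
  "starlike_of_order \<alpha> F \<longleftrightarrow> normalized F \<and> locally_biholomorphic F \<and>
    (\<forall>z\<in>ball 0 1 - {0}. \<forall>l\<in>support_functionals z. starlike_condition \<alpha> F z l)"
  unfolding starlike_of_order_def starlike_condition_def ..

lemma support_functional_rotate:
  assumes l: "l \<in> support_functionals u" and u: "norm u = 1" and s: "s \<noteq> 0"
  shows "(\<lambda>v. cnj (sgn s) * l v) \<in> support_functionals (s *\<^sub>C u)"
proof (rule support_functionalsI)
  have cl: "bounded_clinear l" and lu: "l u = 1" using l u by (auto simp: support_functionals_def)
  show "bounded_clinear (\<lambda>v. cnj (sgn s) * l v)"
    using cl bounded_linear_compose[OF bounded_linear_mult_right[of "cnj (sgn s)"], of l]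
    by (simp add: bounded_clinear_def scaleC_complex_def)
  show "cmod (cnj (sgn s) * l v) \<le> norm v" for v
    using support_functional_bound[OF l, of v] s by (simp add: norm_mult norm_sgn)
  show "cnj (sgn s) * l (s *\<^sub>C u) = complex_of_real (norm (s *\<^sub>C u))"
  proof -
    have "cnj s * s = complex_of_real (cmod s) * complex_of_real (cmod s)"
      using complex_norm_square[of s] by (simp add: power2_eq_square mult.commute)
    then show ?thesis
      using s by (simp add: bounded_clinear_cmult[OF cl] lu sgn_eq norm_scaleC u)
  qed
  show "s *\<^sub>C u \<noteq> 0" using s u by (metis norm_eq_zero norm_scaleC mult_cancel_left1 mult_eq_0_iff)
qed

lemma support_functional_normalize:
  assumes l: "l \<in> support_functionals z" and z: "z \<noteq> 0"
  shows "l \<in> support_functionals (z /\<^sub>R norm z)" "norm (z /\<^sub>R norm z) = 1"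
proof -
  have bl: "bounded_linear l" using l by (simp add: support_functionals_def bounded_clinear_def)
  have "l (z /\<^sub>R norm z) = 1"
    using l z linear_cmul[OF bounded_linear.linear[OF bl], of "inverse (norm z)" z]
    by (simp add: support_functionals_def scaleR_conv_of_real)
  then show "l \<in> support_functionals (z /\<^sub>R norm z)" "norm (z /\<^sub>R norm z) = 1"
    using l z by (simp_all add: support_functionals_def)
qed

lemma restriction_to_line:
  fixes f :: "'a::complex_banach \<Rightarrow> complex"
  assumes f: "cholomorphic_on (ball 0 1) f" and u: "norm u = 1"
  shows "(\<lambda>s. f (s *\<^sub>C u)) holomorphic_on ball 0 1"
    and "s \<in> ball 0 1 \<Longrightarrow> deriv (\<lambda>s. f (s *\<^sub>C u)) s = blinfun_apply (fderiv f (s *\<^sub>C u)) u"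
proof -
  have id: "bounded_clinear (\<lambda>x::complex. x)" by (simp add: bounded_clinear_def)
  have mem: "0 + s *\<^sub>C u \<in> ball 0 1" if "s \<in> ball 0 1" for s
    using that u by (simp add: norm_scaleC)
  have D: "((\<lambda>s. f (s *\<^sub>C u)) has_field_derivative blinfun_apply (fderiv f (s *\<^sub>C u)) u) (at s)"
    if "s \<in> ball 0 1" for s
    using fderiv_along_line[OF f id mem[OF that]] by simp
  show "(\<lambda>s. f (s *\<^sub>C u)) holomorphic_on ball 0 1"
    by (subst holomorphic_on_open) (use D in blast)+
  show "s \<in> ball 0 1 \<Longrightarrow> deriv (\<lambda>s. f (s *\<^sub>C u)) s = blinfun_apply (fderiv f (s *\<^sub>C u)) u"
    using D DERIV_imp_deriv by blast
qed

text \<open>The index drops by one because \<open>l (F (s u)) = s h s\<close> for \<open>u = z / \<parallel>z\<parallel>\<close>, and the powers of \<open>\<parallel>z\<parallel>\<close> cancel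
  by multilinearity of the derivatives.\<close>

theorem A_eq_taylor:
  fixes f :: "'a::complex_banach \<Rightarrow> complex"
  assumes f: "cholomorphic_on (ball 0 1) f" and F: "F = (\<lambda>z. f z *\<^sub>C z)"
    and z: "z \<noteq> 0" and l: "l \<in> support_functionals z"
  defines "h \<equiv> \<lambda>s. f (s *\<^sub>C (z /\<^sub>R norm z))"
  shows "A2 F l z = taylor h 1" "A3 F l z = taylor h 2" "A4 F l z = taylor h 3"
proof -
  define u where "u = z /\<^sub>R norm z"
  define g where "g s = l (F (s *\<^sub>C u))" for s
  have u: "norm u = 1" and lu: "l \<in> support_functionals u"
    using support_functional_normalize[OF l z] by (simp_all add: u_def)
  have cl: "bounded_clinear l" "l u = 1" using lu u by (auto simp: support_functionals_def)
  then have bl: "bounded_linear l" by (simp add: bounded_clinear_def)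
  have hol: "cholomorphic_on (ball 0 1) F" unfolding F by (rule cholomorphic_multiplier(1)[OF f])
  note derivs = higher_deriv_along_line[OF hol cl(1) u, folded g_def[abs_def]]
  have g: "g s = s * h s" for s
    unfolding g_def F h_def u_def[symmetric] bounded_clinear_cmult[OF cl(1)] cl(2) by simp
  have h_hol: "h holomorphic_on ball 0 1"
    unfolding h_def u_def[symmetric] by (rule restriction_to_line(1)[OF f u])
  then have "g holomorphic_on ball 0 1" unfolding g by (intro holomorphic_intros)
  then have "fps_expansion g 0 = fps_X * fps_expansion h 0"
    by (rule fps_eq_on_disc[OF has_fps_expansion_disc])
      (auto intro!: fps_expansion_intros has_fps_expansion_disc h_hol simp: g)
  then have "taylor g (Suc n) = taylor h n" for n by simp
  then have h: "(deriv ^^ Suc n) g 0 = fact (Suc n) * taylor h n" for n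
    by (simp add: fps_expansion_def field_simps del: funpow.simps fact_Suc)
  have zu: "z = norm z *\<^sub>R u" using z by (simp add: u_def)
  have scale: "l (r *\<^sub>R x) = complex_of_real r * l x" for r x
    using linear_cmul[OF bounded_linear.linear[OF bl]] by (simp add: scaleR_conv_of_real)
  have nz: "complex_of_real (norm z) \<noteq> 0" using z by simp
  have "l (fderiv (fderiv F) 0 z z) = complex_of_real (norm z) ^ 2 * l (fderiv (fderiv F) 0 u u)"
    by (subst (1 2) zu) (simp add: blinfun.scaleR_left blinfun.scaleR_right scale power2_eq_square)
  then show "A2 F l z = taylor h 1"
    using h[of 1] nz derivs(1) by (simp add: A2_def numeral_2_eq_2 mult.commute)
  have "l (fderiv (fderiv (fderiv F)) 0 z z z)
      = complex_of_real (norm z) ^ 3 * l (fderiv (fderiv (fderiv F)) 0 u u u)"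
    by (subst (1 2 3) zu) (simp add: blinfun.scaleR_left blinfun.scaleR_right scale power3_eq_cube)
  then show "A3 F l z = taylor h 2"
    using h[of 2] nz derivs(2) by (simp add: A3_def numeral_3_eq_3 numeral_2_eq_2 mult.commute)
  have "l (fderiv (fderiv (fderiv (fderiv F))) 0 z z z z)
      = complex_of_real (norm z) ^ 4 * l (fderiv (fderiv (fderiv (fderiv F))) 0 u u u u)"
    by (subst (1 2 3 4) zu) (simp add: blinfun.scaleR_left blinfun.scaleR_right scale power4_eq_xxxx)
  then show "A4 F l z = taylor h 3"
    using h[of 3] nz derivs(3) by (simp add: A4_def numeral_eq_Suc mult.commute)
qed

text \<open>The condition on \<open>F\<close> at the points \<open>s u\<close>, with the rotated functionals, says that \<open>h\<close> satisfies the
  hypotheses of the one-variable estimate. At \<open>s = 0\<close> these hold because of \<open>f 0 = 1\<close> and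
  \<open>\<alpha> < 1\<close>.\<close>

theorem starlike_mapping_det_bound:
  fixes f :: "'a::complex_banach \<Rightarrow> complex"
  assumes \<alpha>: "0 \<le> \<alpha>" "\<alpha> < 1"
    and f: "cholomorphic_on (ball 0 1) f" and f0: "f 0 = 1" and F: "F = (\<lambda>z. f z *\<^sub>C z)"
    and star: "starlike_of_order \<alpha> F" and z: "z \<noteq> 0" and l: "l \<in> support_functionals z"
  shows "cmod (toeplitz_det (A2 F l z) (A3 F l z) (A4 F l z)) \<le> det_bound \<alpha>"
proof -
  define u where "u = z /\<^sub>R norm z"
  define h where "h s = f (s *\<^sub>C u)" for s
  have u: "norm u = 1" and lu: "l \<in> support_functionals u"
    using support_functional_normalize[OF l z] by (simp_all add: u_def)
  have half_plane: "h s \<noteq> 0 \<and> Re (1 + s * deriv h s / h s) > \<alpha>" if s: "s \<in> ball 0 1" for s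
  proof (cases "s = 0")
    case True
    then show ?thesis using f0 \<alpha> by (simp add: h_def)
  next
    case False
    let ?z = "s *\<^sub>C u"
    have mem: "?z \<in> ball 0 1" using s u by (simp add: norm_scaleC)
    have nz: "?z \<noteq> 0" using False u by (metis norm_eq_zero norm_scaleC mult_cancel_left1 mult_eq_0_iff)
    have "bij (blinfun_apply (fderiv F ?z))"
      using star mem by (simp add: starlike_of_order_iff locally_biholomorphic_def)
    moreover have "starlike_condition \<alpha> F ?z (\<lambda>v. cnj (sgn s) * l v)"
      using star mem nz support_functional_rotate[OF lu u False] by (simp add: starlike_of_order_iff)
    ultimately have Re: "Re ((f ?z + blinfun_apply (fderiv f ?z) ?z) / f ?z) > \<alpha>"
      using starlike_condition_multiplier[OF \<alpha>(1) f mem nz _ support_functional_rotate[OF lu u False]]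
      unfolding F by blast
    then have "f ?z \<noteq> 0" using \<alpha>(1) by auto
    moreover have "blinfun_apply (fderiv f ?z) ?z = s * deriv h s"
      unfolding h_def[abs_def] restriction_to_line(2)[OF f u s] cholomorphic_on_fderiv(2)[OF f mem]
      by (simp add: scaleC_complex_def)
    ultimately show ?thesis using Re by (simp add: h_def add_divide_distrib)
  qed
  have "h holomorphic_on ball 0 1"
    unfolding h_def[abs_def] by (rule restriction_to_line(1)[OF f u])
  moreover have "h 0 = 1" by (simp add: h_def f0)
  ultimately have "cmod (toeplitz_det (taylor h 1) (taylor h 2) (taylor h 3)) \<le> det_bound \<alpha>"
    using half_plane by (intro starlike_toeplitz_det_bound[OF \<alpha>(2)]) auto
  then show ?thesis
    unfolding A_eq_taylor[OF f F z l] by (simp add: h_def[abs_def] u_def)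
qed

section \<open>The extremal mapping\<close>

lemma cholomorphic_compose_functional:
  assumes l: "bounded_clinear l" "\<And>x. cmod (l x) \<le> norm x" and \<phi>: "\<phi> holomorphic_on ball 0 1"
  shows "cholomorphic_on (ball 0 1) (\<lambda>x. \<phi> (l x))"
    and "z \<in> ball 0 1 \<Longrightarrow> blinfun_apply (fderiv (\<lambda>x. \<phi> (l x)) z) v = deriv \<phi> (l z) * l v"
proof -
  have D: "((\<lambda>x. \<phi> (l x)) has_derivative (\<lambda>v. deriv \<phi> (l z) * l v)) (at z)" if "z \<in> ball 0 1" for z
  proof -
    have "l z \<in> ball 0 1" using that le_less_trans[OF l(2)[of z], of 1] by simp
    then have "(\<phi> has_field_derivative deriv \<phi> (l z)) (at (l z))"
      using \<phi> holomorphic_derivI[OF \<phi> open_ball] by blast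
    then show ?thesis
      unfolding has_field_derivative_def
      using has_derivative_compose[OF bounded_linear.has_derivative[OF bounded_clinear_bounded_linear[OF l(1)] has_derivative_ident]]
      by blast
  qed
  have "bounded_clinear (\<lambda>v. c * l v)" for c
    using l(1) bounded_linear_compose[OF bounded_linear_mult_right[of c], of l]
    by (simp add: bounded_clinear_def scaleC_complex_def)
  with D show "cholomorphic_on (ball 0 1) (\<lambda>x. \<phi> (l x))"
    unfolding cholomorphic_on_def by blast
  show "z \<in> ball 0 1 \<Longrightarrow> blinfun_apply (fderiv (\<lambda>x. \<phi> (l x)) z) v = deriv \<phi> (l z) * l v"
    using fderiv_eqI[OF D] by simp
qed

text \<open>The Sherman-Morrison formula for the inverse. Derivatives of the mappings \<open>\<phi> (l z) z\<close> have this
  form.\<close>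

lemma rank_one_perturbation_bij:
  fixes z :: "'a::complex_banach"
  assumes l: "bounded_clinear l" and a: "a \<noteq> 0" "a + b * l z \<noteq> 0"
  shows "bij (\<lambda>v. a *\<^sub>C v + (b * l v) *\<^sub>C z)"
    and "bounded_clinear (inv (\<lambda>v. a *\<^sub>C v + (b * l v) *\<^sub>C z))"
proof -
  define T where "T = (\<lambda>v. a *\<^sub>C v + (b * l v) *\<^sub>C z)"
  define c where "c = b / (a * (a + b * l z))"
  define G where "G = (\<lambda>w. (1 / a) *\<^sub>C w - (c * l w) *\<^sub>C z)"
  note bl = bounded_clinear_bounded_linear[OF l]
  have l_add: "l (x + y) = l x + l y" and l_diff: "l (x - y) = l x - l y" for x y
    using linear_add[OF bounded_linear.linear[OF bl]] linear_diff[OF bounded_linear.linear[OF bl]] by auto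
  note l_mult = bounded_clinear_cmult[OF l]
  have GT: "G (T v) = v" for v
  proof -
    have "G (T v) = ((1 / a) * a) *\<^sub>C v + ((1 / a) * (b * l v) - c * (a * l v + b * l v * l z)) *\<^sub>C z"
      by (simp add: G_def T_def scaleC_add_right scaleC_scaleC l_add l_mult scaleC_diff_left)
    moreover have "(1 / a) * (b * l v) - c * (a * l v + b * l v * l z) = 0"
      using a by (simp add: c_def divide_simps) (simp add: algebra_simps)
    ultimately show ?thesis using a by (simp add: scaleC_one)
  qed
  have TG: "T (G w) = w" for w
  proof -
    have "T (G w) = (a * (1 / a)) *\<^sub>C w + (b * (1 / a * l w - c * l w * l z) - a * (c * l w)) *\<^sub>C z"
      by (simp add: G_def T_def scaleC_diff_right scaleC_scaleC l_diff l_mult scaleC_diff_left)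
    moreover have "b * (1 / a * l w - c * l w * l z) - a * (c * l w) = 0"
      using a by (simp add: c_def divide_simps) (simp add: algebra_simps)
    ultimately show ?thesis using a by (simp add: scaleC_one)
  qed
  show "bij (\<lambda>v. a *\<^sub>C v + (b * l v) *\<^sub>C z)"
    unfolding T_def[symmetric] using GT TG by (metis bijI')
  have "inv T = G" using GT TG by (intro inv_equality)
  moreover have "bounded_linear G"
    unfolding G_def
    by (intro bounded_linear_sub bounded_linear_scaleC_right
        bounded_linear_compose[OF bounded_linear_scaleC_left[of z]]
        bounded_linear_compose[OF bounded_linear_mult_right] bl)
  moreover have "G (k *\<^sub>C w) = k *\<^sub>C G w" for k w
    by (simp add: G_def l_mult scaleC_diff_right scaleC_scaleC mult_ac)
  ultimately show "bounded_clinear (inv (\<lambda>v. a *\<^sub>C v + (b * l v) *\<^sub>C z))"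
    unfolding T_def[symmetric] by (simp add: bounded_clinear_def)
qed

text \<open>The principal branch of \<open>(1 - \<i> s)\<^bsup>-2(1-\<alpha>)\<^esup>\<close>.\<close>

definition extremal :: "real \<Rightarrow> complex \<Rightarrow> complex"
  where "extremal \<alpha> s = exp (- 2 * complex_of_real (1 - \<alpha>) * Ln (1 - \<i> * s))"

lemma extremal:
  shows "extremal \<alpha> 0 = 1" "extremal \<alpha> s \<noteq> 0" "extremal \<alpha> holomorphic_on ball 0 1"
    and "s \<in> ball 0 1 \<Longrightarrow> 1 - \<i> * s \<noteq> 0"
    and "s \<in> ball 0 1 \<Longrightarrow> deriv (extremal \<alpha>) s = extremal \<alpha> s * (2 * complex_of_real (1 - \<alpha>) * \<i> / (1 - \<i> * s))"
proof -
  show "extremal \<alpha> 0 = 1" "extremal \<alpha> s \<noteq> 0" by (simp_all add: extremal_def)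
  have pos: "Re (1 - \<i> * s) > 0" if "s \<in> ball 0 1" for s
    using that abs_Im_le_cmod[of s] by simp
  show nz: "1 - \<i> * s \<noteq> 0" if "s \<in> ball 0 1" for s
    using pos[OF that] by (metis less_irrefl zero_complex.simps(1))
  have slit: "1 - \<i> * s \<notin> \<real>\<^sub>\<le>\<^sub>0" if "s \<in> ball 0 1" for s
    using pos[OF that] by (auto simp: complex_nonpos_Reals_iff)
  have D: "(extremal \<alpha> has_field_derivative extremal \<alpha> s * (2 * complex_of_real (1 - \<alpha>) * \<i> / (1 - \<i> * s))) (at s)"
    if "s \<in> ball 0 1" for s
  proof -
    have "((\<lambda>s. - 2 * complex_of_real (1 - \<alpha>) * Ln (1 - \<i> * s)) has_field_derivative
        2 * complex_of_real (1 - \<alpha>) * \<i> / (1 - \<i> * s)) (at s)"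
      using slit[OF that] nz[OF that] by (auto intro!: derivative_eq_intros simp: divide_simps) (simp add: algebra_simps)
    from DERIV_fun_exp[OF this] show ?thesis unfolding extremal_def[abs_def] .
  qed
  show "extremal \<alpha> holomorphic_on ball 0 1"
    by (subst holomorphic_on_open) (use D in blast)+
  show "s \<in> ball 0 1 \<Longrightarrow> deriv (extremal \<alpha>) s = extremal \<alpha> s * (2 * complex_of_real (1 - \<alpha>) * \<i> / (1 - \<i> * s))"
    using D DERIV_imp_deriv by blast
qed

text \<open>The expression is an affine function of \<open>(1 + t) / (1 - t)\<close>, which maps the disk to the right half
  plane.\<close>

lemma Re_extremal_quotient:
  assumes "\<beta> > 0" "cmod t < 1"
  shows "Re (1 + 2 * complex_of_real \<beta> * t / (1 - t)) > 1 - \<beta>"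
proof -
  define q where "q = (1 + t) / (1 - t)"
  have nz: "1 - t \<noteq> 0" using assms by auto
  have "Phi 0 t \<in> Phi 0 ` ball 0 1" using assms(2) by simp
  then have "Re q > 0" unfolding Phi_0_image by (simp add: Phi_def q_def)
  moreover have "1 + 2 * complex_of_real \<beta> * t / (1 - t)
      = complex_of_real (1 - \<beta>) + complex_of_real \<beta> * q"
    using nz by (simp add: q_def field_simps)
  ultimately show ?thesis
    using assms(1) by simp
qed

text \<open>Along the line spanned by \<open>z\<close> the multiplier is the function \<open>extremal \<alpha>\<close>, which solves the
  differential equation with \<open>\<omega> s = \<i> s\<close>. At an arbitrary point \<open>x\<close> of the ball the starlikeness
  condition depends on \<open>l x\<close> only, and \<open>\<bar>l x\<bar> < 1\<close>.\<close>

theorem starlike_mapping_extremal: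
  fixes l :: "'a::complex_banach \<Rightarrow> complex" and \<alpha> :: real
  assumes \<alpha>: "0 \<le> \<alpha>" "\<alpha> < 1" and l: "l \<in> support_functionals z" and z: "z \<noteq> 0"
  defines "f \<equiv> \<lambda>x. extremal \<alpha> (l x)"
  defines "F \<equiv> \<lambda>x. f x *\<^sub>C x"
  shows "cholomorphic_on (ball 0 1) f" "f 0 = 1" "starlike_of_order \<alpha> F"
    and "cmod (toeplitz_det (A2 F l z) (A3 F l z) (A4 F l z)) = det_bound \<alpha>"
proof -
  define \<beta> where "\<beta> = 1 - \<alpha>"
  have \<beta>: "\<beta> > 0" using \<alpha> by (simp add: \<beta>_def)
  have cl: "bounded_clinear l" using l by (simp add: support_functionals_def)
  have bound: "cmod (l x) \<le> norm x" for x by (rule support_functional_bound[OF l])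
  have disc: "l x \<in> ball 0 1" if "x \<in> ball 0 1" for x
    using that le_less_trans[OF bound[of x], of 1] by simp
  have l0: "l 0 = 0" using linear_0[OF bounded_linear.linear[OF bounded_clinear_bounded_linear[OF cl]]] .
  note comp = cholomorphic_compose_functional[OF cl bound extremal(3)[of \<alpha>], folded f_def]
  show f: "cholomorphic_on (ball 0 1) f" by (rule comp(1))
  show f0: "f 0 = 1" by (simp add: f_def l0 extremal(1))
  define k where "k x = 2 * complex_of_real \<beta> * \<i> / (1 - \<i> * l x)" for x
  have Df: "blinfun_apply (fderiv f x) v = f x * k x * l v" if "x \<in> ball 0 1" for x v
    using comp(2)[OF that, of v] extremal(5)[OF disc[OF that], of \<alpha>] by (simp add: f_def k_def \<beta>_def)
  have DF: "blinfun_apply (fderiv F x) = (\<lambda>v. f x *\<^sub>C v + (f x * k x * l v) *\<^sub>C x)" if "x \<in> ball 0 1" for x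
    using cholomorphic_multiplier(2)[OF f that] Df[OF that] unfolding F_def by auto
  have Re: "Re (1 + k x * l x) > \<alpha>" if "x \<in> ball 0 1" for x
    using Re_extremal_quotient[OF \<beta>, of "\<i> * l x"] disc[OF that]
    by (simp add: k_def \<beta>_def norm_mult mult_ac)
  have f_nz: "f x \<noteq> 0" for x by (simp add: f_def extremal(2))
  have factor: "f x + f x * k x * l x = f x * (1 + k x * l x)" for x
    by (simp add: algebra_simps)
  have nz: "f x + f x * k x * l x \<noteq> 0" if "x \<in> ball 0 1" for x
  proof -
    have "1 + k x * l x \<noteq> 0"
    proof
      assume "1 + k x * l x = 0"
      with Re[OF that] have "Re 0 > \<alpha>" by (simp only:)
      then show False using \<alpha>(1) by simp
    qed
    then show ?thesis using f_nz[of x] unfolding factor by simp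
  qed
  note inverse = rank_one_perturbation_bij[OF cl f_nz nz]
  have bij: "bij (blinfun_apply (fderiv F x))" if "x \<in> ball 0 1" for x
    unfolding DF[OF that] by (rule inverse(1)[OF that])
  have F: "cholomorphic_on (ball 0 1) F"
    unfolding F_def by (rule cholomorphic_multiplier(1)[OF f])
  have "fderiv F 0 = id_blinfun"
    by (rule blinfun_eqI) (simp add: DF f0 scaleC_one)
  then have "normalized F"
    using F by (simp add: normalized_def F_def)
  moreover have "locally_biholomorphic F"
    unfolding locally_biholomorphic_def
  proof (intro conjI ballI F bij)
    fix x :: 'a assume "x \<in> ball 0 1"
    then show "bounded_clinear (inv (blinfun_apply (fderiv F x)))"
      unfolding DF[OF \<open>x \<in> ball 0 1\<close>] by (rule inverse(2))
  qed
  moreover have "starlike_condition \<alpha> F x m" if x: "x \<in> ball 0 1 - {0}" and m: "m \<in> support_functionals x" for x m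
  proof -
    have x': "x \<in> ball 0 1" "x \<noteq> 0" using x by auto
    have "(f x + blinfun_apply (fderiv f x) x) / f x = 1 + k x * l x"
      unfolding Df[OF x'(1)] factor using f_nz[of x] by simp
    then show ?thesis
      using starlike_condition_multiplier[OF \<alpha>(1) f x' bij[OF x'(1), unfolded F_def] m] Re[OF x'(1)]
      unfolding F_def by simp
  qed
  ultimately show "starlike_of_order \<alpha> F" unfolding starlike_of_order_iff by blast
  have "l (z /\<^sub>R norm z) = complex_of_real (norm (z /\<^sub>R norm z))"
    using support_functional_normalize(1)[OF l z] by (simp only: support_functionals_def mem_Collect_eq)
  then have "l (z /\<^sub>R norm z) = 1"
    unfolding support_functional_normalize(2)[OF l z] by simp
  then have h: "(\<lambda>s. f (s *\<^sub>C (z /\<^sub>R norm z))) = extremal \<alpha>"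
    by (simp add: f_def bounded_clinear_cmult[OF cl])
  have "cmod (toeplitz_det (taylor (extremal \<alpha>) 1) (taylor (extremal \<alpha>) 2) (taylor (extremal \<alpha>) 3)) = det_bound \<alpha>"
  proof (rule starlike_toeplitz_det_extremal[OF \<alpha>(2) extremal(3,1)])
    fix s :: complex assume s: "s \<in> ball 0 1"
    show "s * deriv (extremal \<alpha>) s * (1 - \<i> * s) = 2 * complex_of_real (1 - \<alpha>) * (\<i> * s) * extremal \<alpha> s"
      unfolding extremal(5)[OF s] using extremal(4)[OF s] by simp
  qed
  then show "cmod (toeplitz_det (A2 F l z) (A3 F l z) (A4 F l z)) = det_bound \<alpha>"
    unfolding A_eq_taylor[OF f F_def[THEN meta_eq_to_obj_eq] z l] h .
qed

section \<open>The sharp estimate\<close>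

theorem corollary5p2:
  fixes \<alpha> \<alpha>\<^sub>0 bound :: real
  assumes nonzero: "\<exists>x::'a::complex_banach. x \<noteq> 0"
    and alpha0: "\<alpha>\<^sub>0 = (27 - sqrt 129) / 24"
    and alpha: "\<alpha> \<in> {0..\<alpha>\<^sub>0}"
    and bound: "bound =
      4 / 9 * (1 - \<alpha>) ^ 3 * (2 * \<alpha>\<^sup>2 - 7 * \<alpha> + 9) * (8 * \<alpha>\<^sup>2 - 22 * \<alpha> + 21)"
  shows "24 * \<alpha>\<^sub>0\<^sup>2 - 54 * \<alpha>\<^sub>0 + 25 = 0 \<and>
    (\<forall>(f :: 'a \<Rightarrow> complex) F z l.
        cholomorphic_on (ball 0 1) f \<and> f 0 = 1 \<and>
        F = (\<lambda>z. f z *\<^sub>C z) \<and> starlike_of_order \<alpha> F \<and>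
        z \<noteq> 0 \<and> l \<in> support_functionals z \<longrightarrow>
        cmod (A2 F l z ^ 3 - 2 * A2 F l z * A3 F l z ^ 2 - A2 F l z * A4 F l z ^ 2
                + 2 * A3 F l z ^ 2 * A4 F l z) \<le> bound) \<and>
    (\<exists>(f :: 'a \<Rightarrow> complex) F z l.
        cholomorphic_on (ball 0 1) f \<and> f 0 = 1 \<and>
        F = (\<lambda>z. f z *\<^sub>C z) \<and> starlike_of_order \<alpha> F \<and>
        z \<noteq> 0 \<and> l \<in> support_functionals z \<and>
        cmod (A2 F l z ^ 3 - 2 * A2 F l z * A3 F l z ^ 2 - A2 F l z * A4 F l z ^ 2
                + 2 * A3 F l z ^ 2 * A4 F l z) = bound)"
proof -
  have "3 < sqrt 129" by (rule real_less_rsqrt) simp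
  then have \<alpha>: "0 \<le> \<alpha>" "\<alpha> < 1" using alpha alpha0 by auto
  have b: "bound = det_bound \<alpha>" by (simp only: bound det_bound_def)
  have root: "24 * \<alpha>\<^sub>0\<^sup>2 - 54 * \<alpha>\<^sub>0 + 25 = 0"
    unfolding alpha0 by (simp add: power2_eq_square field_simps)
  obtain z :: 'a where z: "z \<noteq> 0" using nonzero by blast
  obtain l where l: "l \<in> support_functionals z"
    using Hahn_Banach_norming[of z] support_functionalsI[OF _ _ _ z] by metis
  show ?thesis
    unfolding b toeplitz_det_def[symmetric]
  proof (intro conjI root allI impI)
    fix f :: "'a \<Rightarrow> complex" and F :: "'a \<Rightarrow> 'a" and z :: 'a and l :: "'a \<Rightarrow> complex"
    assume "cholomorphic_on (ball 0 1) f \<and> f 0 = 1 \<and> F = (\<lambda>z. f z *\<^sub>C z) \<and> starlike_of_order \<alpha> F \<and>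
        z \<noteq> 0 \<and> l \<in> support_functionals z"
    then show "cmod (toeplitz_det (A2 F l z) (A3 F l z) (A4 F l z)) \<le> det_bound \<alpha>"
      using starlike_mapping_det_bound[OF \<alpha>] by blast
  qed (use starlike_mapping_extremal[OF \<alpha> l z] z l in blast)
qed

end
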